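(* Let $T\ge 1$ be an integer and $\delta\in(0,1]$, and define $c_{T,m,\delta}:=2\left(1+4\log(2Tm/\delta)\right)$. Assume $c_{\mathrm h}>0$. Run the stochastic mirror descent algorithm described in the context with initial condition $X_0=\frac12\mathbf I_n$ and constant step size $\gamma_t=\gamma:=\frac{\eta\beta}{\eta+\beta}$, where $\eta:=\frac{1}{c_{T,m,\delta}\,c_{\mathrm h}\,\sqrt T}$ (with $\gamma=\eta$ if $\beta=+\infty$); equivalently, run its proximal form with $\eta_t=\eta$. Let $X_\star$ be a minimizer of $F_\beta(X)-\mu\,\mathrm{Tr}[X]$ over $X\in\mathcal X$. Then $$\frac1T\sum_{t=0}^{T-1}\frac{F_\beta(X_t)-\mu\,\mathrm{Tr}[X_t]}{n}\ \le\ \frac{F_\beta(X_\star)-\mu\,\mathrm{Tr}[X_\star]}{n}+\frac{c_{T,m,\delta}\,c_{\mathrm h}}{\sqrt T}\left(\log 2+\frac14+\frac1{\sqrt n}\right)+\frac{\|C-\mu\mathbf I_n\|}{T}$$ holds with probability at least $1-\delta$.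
   Context: Problem setting. Let $n,m$ be positive integers, $\Psi\in\mathbb R^{m\times n}$ with $\Psi^\top\Psi=\mathbf I_n$, $V\in\mathbb R^{m\times m}$ symmetric positive semidefinite, $C\in\mathbb R^{n\times n}$ symmetric, $\mu\in\mathbb R$, and $\beta\in(0,+\infty]$ (with $\beta^{-1}=0$ if $\beta=+\infty$). Let $\mathcal X=\{X\in\mathbb R^{n\times n}\text{ symmetric}: 0\preceq X\preceq \mathbf I_n\}$. $\|\cdot\|$ denotes the spectral norm of a matrix, $\langle\cdot,\cdot\rangle$ the Frobenius inner product, and $\|V\|_\infty=\max_i\sum_j|V_{ij}|$. For $Y\in\mathbb R^{n\times n}$ put $\rho(Y)=\mathrm{diag}[\Psi Y\Psi^\top]\in\mathbb R^m$ (the vector of diagonal entries), $\tilde E(Y)=\frac12\rho(Y)^\top V\rho(Y)$, so that $\nabla\tilde E(Y)=\Psi^\top\mathrm{diag}^*[V\rho(Y)]\Psi$, where $\mathrm{diag}^*[v]$ is the diagonal matrix with diagonal $v$. Define $E(X)=\mathrm{Tr}[CX]+\tilde E(X)$, the Fermi-Dirac entropy $S_{\mathrm{FD}}(X)=\mathrm{Tr}[X\log X]+\mathrm{Tr}[(\mathbf I_n-X)\log(\mathbf I_n-X)]$ on $\mathcal X$ (with $0\log 0=0$), and $F_\beta(X)=E(X)+\beta^{-1}S_{\mathrm{FD}}(X)$. Let $c_\Psi=\max_{p}\sum_{i=1}^n|\Psi_{pi}|^2$ and $c_{\mathrm h}=c_\Psi\|V\|_\infty$. Algorithm. Let $z_0,\dots,z_{T-1}$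 be i.i.d. standard Gaussian vectors in $\mathbb R^n$. Given $X_t$, set $\hat X_t=X_t^{1/2}z_tz_t^\top X_t^{1/2}$, $\tilde G_t=\nabla\tilde E(\hat X_t)$, $G_t=C+\tilde G_t$, and define $X_{t+1}$ by $$\nabla S_{\mathrm{FD}}(X_{t+1})=(1-\beta^{-1}\gamma_t)\nabla S_{\mathrm{FD}}(X_t)-\gamma_t(G_t-\mu\mathbf I_n),$$ where $\nabla S_{\mathrm{FD}}(X)=\log(X(\mathbf I_n-X)^{-1})$ has inverse map $X^*\mapsto(\mathbf I_n+e^{-X^*})^{-1}$ on symmetric matrices. Equivalently, when $\gamma_t=\frac{\eta_t\beta}{\eta_t+\beta}$ (with $\gamma_t=\eta_t$ if $\beta=+\infty$), $X_{t+1}$ is the minimizer over $X\in\mathcal X$ of $E(X_t)+\langle G_t-\mu\mathbf I_n,X-X_t\rangle+\beta^{-1}S_{\mathrm{FD}}(X)+\eta_t^{-1}D(X\|X_t)$, where $D(Y\|X)=S_{\mathrm{FD}}(Y)-S_{\mathrm{FD}}(X)-\langle\nabla S_{\mathrm{FD}}(X),Y-X\rangle$. *)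

theory Defs
  imports "HOL-Probability.Probability"
begin

text \<open>
  Matrices in \<open>\<real>\<^sup>m\<^sup>\<times>\<^sup>n\<close> have type \<^typ>\<open>real^'n^'m\<close>, with \<open>n = CARD('n)\<close> and \<open>m = CARD('m)\<close>.
  On this type \<open>A \<bullet> B\<close> is the Frobenius inner product, whereas \<open>norm A\<close> is the Frobenius norm;
  the spectral norm is the operator norm \<open>onorm ((*v) A)\<close>.
\<close>

subsection \<open>Symmetric matrices and functional calculus\<close>

definition psd :: "real^'n^'n \<Rightarrow> bool" where
  "psd A \<longleftrightarrow> transpose A = A \<and> (\<forall>x. 0 \<le> x \<bullet> (A *v x))"

definition pd :: "real^'n^'n \<Rightarrow> bool" where
  "pd A \<longleftrightarrow> transpose A = A \<and> (\<forall>x. x \<noteq> 0 \<longrightarrow> 0 < x \<bullet> (A *v x))"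

definition diag_mat :: "real^'n \<Rightarrow> real^'n^'n" where
  "diag_mat v = (\<chi> i j. if i = j then v $ i else 0)"

definition outer :: "real^'n \<Rightarrow> real^'n \<Rightarrow> real^'n^'n" where
  "outer v w = (\<chi> i j. v $ i * w $ j)"

text \<open>
  \<open>mat_fun f A\<close> is \<open>f(A)\<close> for a symmetric matrix \<open>A\<close>: the function \<open>f\<close> is applied to the eigenvalues
  in an orthogonal diagonalization. Lemma \<open>mat_fun_diagonalization\<close> below shows that the result does
  not depend on the chosen diagonalization. The value is arbitrary if \<open>A\<close> is not symmetric.
\<close>

definition mat_fun :: "(real \<Rightarrow> real) \<Rightarrow> real^'n^'n \<Rightarrow> real^'n^'n" where
  "mat_fun f A = (THE B. \<exists>Q d. orthogonal_matrix Q
      \<and> A = Q ** diag_mat d ** transpose Q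
      \<and> B = Q ** diag_mat (\<chi> i. f (d $ i)) ** transpose Q)"

lemma diag_mat_mult_right: "(A ** diag_mat d) $ i $ j = A $ i $ j * d $ j"
  by (simp add: matrix_matrix_mult_def diag_mat_def if_distrib cong: if_cong)

lemma diag_mat_mult_left: "(diag_mat d ** A) $ i $ j = d $ i * A $ i $ j"
  by (simp add: matrix_matrix_mult_def diag_mat_def if_distrib[of "\<lambda>x. x * _"] cong: if_cong)

lemma mat_fun_diagonalization_unique:
  assumes P: "orthogonal_matrix P" and Q: "orthogonal_matrix Q"
    and eq: "P ** diag_mat c ** transpose P = Q ** diag_mat d ** transpose Q"
  shows "P ** diag_mat (\<chi> i. f (c $ i)) ** transpose P
       = Q ** diag_mat (\<chi> i. f (d $ i)) ** transpose Q"
proof -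
  define W where "W = transpose Q ** P"
  have PP: "transpose P ** P = mat 1" "P ** transpose P = mat 1"
    and QQ: "transpose Q ** Q = mat 1" "Q ** transpose Q = mat 1"
    using P Q by (auto simp: orthogonal_matrix_def)
  have "transpose Q ** (P ** diag_mat c ** transpose P) ** P
      = transpose Q ** (Q ** diag_mat d ** transpose Q) ** P"
    by (simp add: eq)
  moreover have "transpose Q ** (P ** diag_mat c ** transpose P) ** P = W ** diag_mat c"
    by (simp add: W_def PP(1) flip: matrix_mul_assoc)
  moreover have "transpose Q ** (Q ** diag_mat d ** transpose Q) ** P = diag_mat d ** W"
    by (simp add: W_def QQ(1) matrix_mul_assoc)
  ultimately have "W ** diag_mat c = diag_mat d ** W"
    by simp
  then have "W $ i $ j * c $ j = d $ i * W $ i $ j" for i j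
    by (simp flip: diag_mat_mult_left diag_mat_mult_right)
  then have zero: "W $ i $ j = 0 \<or> c $ j = d $ i" for i j
    using mult_cancel_left[of "W $ i $ j" "c $ j" "d $ i"] by (simp add: mult.commute)
  have "W $ i $ j * f (c $ j) = f (d $ i) * W $ i $ j" for i j
    using zero[of i j] by auto
  then have W: "W ** diag_mat (\<chi> i. f (c $ i)) = diag_mat (\<chi> i. f (d $ i)) ** W"
    by (simp add: vec_eq_iff diag_mat_mult_left diag_mat_mult_right)
  have "P ** diag_mat (\<chi> i. f (c $ i)) ** transpose P
      = Q ** (W ** diag_mat (\<chi> i. f (c $ i))) ** transpose P"
    by (simp add: W_def matrix_mul_assoc QQ(2))
  also have "\<dots> = Q ** diag_mat (\<chi> i. f (d $ i)) ** transpose Q ** (P ** transpose P)"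
    unfolding W by (simp add: W_def matrix_mul_assoc)
  finally show ?thesis
    by (simp add: PP(2))
qed

lemma mat_fun_diagonalization:
  assumes "orthogonal_matrix Q"
  shows "mat_fun f (Q ** diag_mat d ** transpose Q)
       = Q ** diag_mat (\<chi> i. f (d $ i)) ** transpose Q"
  unfolding mat_fun_def
proof (rule the_equality)
  show "\<exists>P c. orthogonal_matrix P
      \<and> Q ** diag_mat d ** transpose Q = P ** diag_mat c ** transpose P
      \<and> Q ** diag_mat (\<chi> i. f (d $ i)) ** transpose Q
        = P ** diag_mat (\<chi> i. f (c $ i)) ** transpose P"
    by (rule exI[of _ Q], rule exI[of _ d]) (intro conjI assms refl)
  fix B
  assume "\<exists>P c. orthogonal_matrix P
      \<and> Q ** diag_mat d ** transpose Q = P ** diag_mat c ** transpose P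
      \<and> B = P ** diag_mat (\<chi> i. f (c $ i)) ** transpose P"
  then obtain P c where P: "orthogonal_matrix P"
      and eq: "Q ** diag_mat d ** transpose Q = P ** diag_mat c ** transpose P"
      and B: "B = P ** diag_mat (\<chi> i. f (c $ i)) ** transpose P"
    by (elim exE conjE)
  show "B = Q ** diag_mat (\<chi> i. f (d $ i)) ** transpose Q"
    unfolding B by (rule mat_fun_diagonalization_unique[OF P assms eq[symmetric]])
qed

subsection \<open>The constraint set, the entropy and the energy\<close>

definition fermi_set :: "(real^'n^'n) set" where
  "fermi_set = {X. psd X \<and> psd (mat 1 - X)}"

text \<open>The domain of the gradient of the entropy: symmetric \<open>X\<close> with \<open>0 \<prec> X \<prec> I\<close>.\<close>

definition fermi_interior :: "(real^'n^'n) set" where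
  "fermi_interior = {X. pd X \<and> pd (mat 1 - X)}"

text \<open>The convention \<open>0 log 0 = 0\<close> is built in, because \<open>0 * ln 0 = 0\<close>.\<close>

definition S_FD :: "real^'n^'n \<Rightarrow> real" where
  "S_FD X = trace (mat_fun (\<lambda>x. x * ln x) X) + trace (mat_fun (\<lambda>x. x * ln x) (mat 1 - X))"

definition grad_S_FD :: "real^'n^'n \<Rightarrow> real^'n^'n" where
  "grad_S_FD X = mat_fun ln (X ** matrix_inv (mat 1 - X))"

definition bregman_FD :: "real^'n^'n \<Rightarrow> real^'n^'n \<Rightarrow> real" where
  "bregman_FD Y X = S_FD Y - S_FD X - grad_S_FD X \<bullet> (Y - X)"

definition rho :: "real^'n^'m \<Rightarrow> real^'n^'n \<Rightarrow> real^'m" where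
  "rho \<Psi> Y = (\<chi> p. (\<Psi> ** Y ** transpose \<Psi>) $ p $ p)"

definition E_tilde :: "real^'n^'m \<Rightarrow> real^'m^'m \<Rightarrow> real^'n^'n \<Rightarrow> real" where
  "E_tilde \<Psi> V Y = (rho \<Psi> Y \<bullet> (V *v rho \<Psi> Y)) / 2"

definition grad_E_tilde :: "real^'n^'m \<Rightarrow> real^'m^'m \<Rightarrow> real^'n^'n \<Rightarrow> real^'n^'n" where
  "grad_E_tilde \<Psi> V Y = transpose \<Psi> ** diag_mat (V *v rho \<Psi> Y) ** \<Psi>"

lemma rho_nth:
  "rho \<Psi> H $ p = (\<Sum>j\<in>UNIV. \<Sum>i\<in>UNIV. \<Psi> $ p $ i * H $ i $ j * \<Psi> $ p $ j)"
  by (simp add: rho_def matrix_matrix_mult_def transpose_def sum_distrib_right)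

lemma rho_inner:
  fixes \<Psi> :: "real^'a^'b"
  shows "v \<bullet> rho \<Psi> H = (transpose \<Psi> ** diag_mat v ** \<Psi>) \<bullet> H"
proof -
  have entry: "(transpose \<Psi> ** diag_mat v ** \<Psi>) $ i $ j
      = (\<Sum>p\<in>UNIV. \<Psi> $ p $ i * v $ p * \<Psi> $ p $ j)" for i j
  proof -
    have "(A ** \<Psi>) $ i $ j = (\<Sum>p\<in>UNIV. A $ i $ p * \<Psi> $ p $ j)" for A :: "real^'b^'a"
      by (simp add: matrix_matrix_mult_def)
    then show ?thesis
      by (simp add: diag_mat_mult_right) (simp add: transpose_def)
  qed
  let ?t = "\<lambda>i j p. v $ p * (\<Psi> $ p $ i * H $ i $ j * \<Psi> $ p $ j)"
  have "(transpose \<Psi> ** diag_mat v ** \<Psi>) \<bullet> H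
      = (\<Sum>i\<in>UNIV. \<Sum>j\<in>UNIV. (\<Sum>p\<in>UNIV. \<Psi> $ p $ i * v $ p * \<Psi> $ p $ j) * H $ i $ j)"
    by (simp add: inner_vec_def entry)
  also have "\<dots> = (\<Sum>i\<in>UNIV. \<Sum>j\<in>UNIV. \<Sum>p\<in>UNIV. ?t i j p)"
    unfolding sum_distrib_right by (intro sum.cong refl) simp
  also have "\<dots> = (\<Sum>j\<in>UNIV. \<Sum>i\<in>UNIV. \<Sum>p\<in>UNIV. ?t i j p)"
    by (rule sum.swap)
  also have "\<dots> = (\<Sum>j\<in>UNIV. \<Sum>p\<in>UNIV. \<Sum>i\<in>UNIV. ?t i j p)"
    by (intro sum.cong refl sum.swap)
  also have "\<dots> = (\<Sum>p\<in>UNIV. \<Sum>j\<in>UNIV. \<Sum>i\<in>UNIV. ?t i j p)"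
    by (rule sum.swap)
  also have "\<dots> = v \<bullet> rho \<Psi> H"
    by (simp add: inner_vec_def rho_nth sum_distrib_left)
  finally show ?thesis ..
qed

lemma grad_E_tilde_is_gradient:
  assumes "transpose V = V"
  shows "(E_tilde \<Psi> V has_derivative (\<lambda>H. grad_E_tilde \<Psi> V Y \<bullet> H)) (at Y)"
proof -
  have "linear (rho \<Psi>)"
    by (rule linearI)
       (simp_all add: vec_eq_iff rho_nth distrib_left distrib_right sum.distrib
         sum_distrib_left mult.assoc mult.left_commute)
  then have bl: "bounded_linear (rho \<Psi>)"
    by (simp add: linear_conv_bounded_linear)
  have blV: "bounded_linear (\<lambda>H. V *v rho \<Psi> H)"
    using bl bounded_linear_compose matrix_vector_mul_bounded_linear by blast
  have sym: "rho \<Psi> Y \<bullet> (V *v rho \<Psi> H) = (V *v rho \<Psi> Y) \<bullet> rho \<Psi> H" for H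
    by (metis assms dot_lmul_matrix inner_commute transpose_matrix_vector)
  have "(E_tilde \<Psi> V has_derivative
      (\<lambda>H. (rho \<Psi> Y \<bullet> (V *v rho \<Psi> H) + rho \<Psi> H \<bullet> (V *v rho \<Psi> Y)) / 2)) (at Y)"
    unfolding E_tilde_def divide_inverse
    by (intro has_derivative_mult_left has_derivative_inner
        bounded_linear_imp_has_derivative bl blV)
  also have "(\<lambda>H. (rho \<Psi> Y \<bullet> (V *v rho \<Psi> H) + rho \<Psi> H \<bullet> (V *v rho \<Psi> Y)) / 2)
      = (\<lambda>H. grad_E_tilde \<Psi> V Y \<bullet> H)"
    by (simp add: sym inner_commute[of _ "V *v rho \<Psi> Y"] grad_E_tilde_def flip: rho_inner)
  finally show ?thesis .
qed

definition energy :: "real^'n^'m \<Rightarrow> real^'m^'m \<Rightarrow> real^'n^'n \<Rightarrow> real^'n^'n \<Rightarrow> real" where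
  "energy \<Psi> V C X = trace (C ** X) + E_tilde \<Psi> V X"

text \<open>\<open>\<beta>\<^sup>-\<^sup>1\<close> for \<open>\<beta> \<in> (0,\<infinity>]\<close>, with value \<open>0\<close> at \<open>\<beta> = \<infinity>\<close> (in \<^typ>\<open>ereal\<close>, \<open>inverse \<infinity> = 0\<close>).\<close>

definition beta_inv :: "ereal \<Rightarrow> real" where
  "beta_inv \<beta> = real_of_ereal (inverse \<beta>)"

definition free_energy ::
  "real^'n^'m \<Rightarrow> real^'m^'m \<Rightarrow> real^'n^'n \<Rightarrow> ereal \<Rightarrow> real^'n^'n \<Rightarrow> real" where
  "free_energy \<Psi> V C \<beta> X = energy \<Psi> V C X + beta_inv \<beta> * S_FD X"

definition c_Psi :: "real^'n^'m \<Rightarrow> real" where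
  "c_Psi \<Psi> = (MAX p. \<Sum>i\<in>UNIV. \<bar>\<Psi> $ p $ i\<bar>\<^sup>2)"

definition norm_inf :: "real^'m^'m \<Rightarrow> real" where
  "norm_inf V = (MAX i. \<Sum>j\<in>UNIV. \<bar>V $ i $ j\<bar>)"

subsection \<open>Stochastic mirror descent\<close>

definition std_gaussian_density :: "real^'n \<Rightarrow> real" where
  "std_gaussian_density x = (\<Prod>i\<in>UNIV. std_normal_density (x $ i))"

definition sampled_matrix :: "real^'n^'n \<Rightarrow> real^'n \<Rightarrow> real^'n^'n" where
  "sampled_matrix X z = mat_fun sqrt X ** outer z z ** mat_fun sqrt X"

definition stoch_grad ::
  "real^'n^'m \<Rightarrow> real^'m^'m \<Rightarrow> real^'n^'n \<Rightarrow> real^'n^'n \<Rightarrow> real^'n \<Rightarrow> real^'n^'n" where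
  "stoch_grad \<Psi> V C X z = C + grad_E_tilde \<Psi> V (sampled_matrix X z)"

definition step_size :: "ereal \<Rightarrow> real \<Rightarrow> real" where
  "step_size \<beta> \<eta> = (if \<beta> = \<infinity> then \<eta> else \<eta> * real_of_ereal \<beta> / (\<eta> + real_of_ereal \<beta>))"

text \<open>One step \<open>X \<mapsto> X'\<close> with step size \<open>\<gamma>\<close> and stochastic gradient \<open>G\<close>.\<close>

definition mirror_step ::
  "ereal \<Rightarrow> real \<Rightarrow> real \<Rightarrow> real^'n^'n \<Rightarrow> real^'n^'n \<Rightarrow> real^'n^'n \<Rightarrow> bool" where
  "mirror_step \<beta> \<mu> \<gamma> G X X' \<longleftrightarrow> X' \<in> fermi_interior \<and>
     grad_S_FD X' = (1 - beta_inv \<beta> * \<gamma>) *\<^sub>R grad_S_FD X - \<gamma> *\<^sub>R (G - \<mu> *\<^sub>R mat 1)"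

text \<open>The same step in proximal form; here \<open>\<eta>\<close> is the proximal parameter, not \<open>\<gamma>\<close>.\<close>

definition proximal_step ::
  "real^'n^'m \<Rightarrow> real^'m^'m \<Rightarrow> real^'n^'n \<Rightarrow> ereal \<Rightarrow> real \<Rightarrow> real
    \<Rightarrow> real^'n^'n \<Rightarrow> real^'n^'n \<Rightarrow> real^'n^'n \<Rightarrow> bool" where
  "proximal_step \<Psi> V C \<beta> \<mu> \<eta> G X X' \<longleftrightarrow>
     is_arg_min (\<lambda>Y. energy \<Psi> V C X + (G - \<mu> *\<^sub>R mat 1) \<bullet> (Y - X)
                   + beta_inv \<beta> * S_FD Y + inverse \<eta> * bregman_FD Y X)
       (\<lambda>Y. Y \<in> fermi_set) X'"

end

theory Submission
  imports Defs
begin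

text \<open>
  The algorithm is followed through the dual variables \<open>Y\<^sub>t = grad_S_FD X\<^sub>t\<close>, so that
  \<open>X\<^sub>t = mat_fun logistic Y\<^sub>t\<close> and \<open>Y\<^sub>0 = 0\<close>. Both forms of the step say
  \<open>(1/\<eta> + 1/\<beta>) Y\<^sub>t\<^sub>+\<^sub>1 = Y\<^sub>t/\<eta> - (G\<^sub>t - \<mu> I)\<close>. For the mirror step this is a rearrangement. For the proximal
  step it holds because, up to a constant, the objective is a positive multiple of the Bregman
  divergence to \<open>mat_fun logistic Y\<^sub>t\<^sub>+\<^sub>1\<close>, and that divergence is at least twice the squared Frobenius
  distance (\<open>S_FD_bregman_lower_bound\<close>, a matrix form of the binary Pinsker inequality), so that the
  minimizer is unique.

  The deterministic part (\<open>mirror_descent_regret\<close>) is the usual analysis of mirror descent with a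
  composite entropy term. The three-point identity for Bregman divergences bounds one step, and three
  quantities telescope in the sum over the steps: the divergence of \<open>X\<^sub>\<star>\<close> to \<open>X\<^sub>t\<close>, which starts at
  most at \<open>n log 2\<close>; the linear term \<open>\<langle>C - \<mu> I, X\<^sub>t\<rangle>\<close>, which gives \<open>n \<parallel>C - \<mu> I\<parallel>\<close>; and the entropy,
  which \<open>X\<^sub>0 = I/2\<close> minimizes, so that it contributes nothing positive. Two stochastic terms remain. The
  first is the squared Frobenius norm of the sampled gradient, times \<open>\<eta>/8\<close>, which comes from completing
  the square against the Bregman divergence between consecutive iterates. The second is the noise
  \<open>\<xi>\<^sub>t = \<langle>\<nabla>E(X\<^sub>t) - \<nabla>E(X'\<^sub>t), X\<^sub>t - X\<^sub>\<star>\<rangle>\<close>, where \<open>X'\<^sub>t\<close> is the sampled matrix and \<open>E\<close> the convex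
  quadratic part of the energy; it enters when convexity linearizes \<open>E\<close>.

  Given the past, both are controlled by quadratic forms in a standard Gaussian vector. Each entry of
  \<open>rho \<Psi> X'\<^sub>t\<close>, on which the sampled gradient depends, is the square of a centred Gaussian variable of
  variance at most \<open>c_Psi \<Psi>\<close>. And \<open>\<xi>\<^sub>t = trace A - z \<bullet> (A *v z)\<close> for a symmetric matrix \<open>A\<close> whose
  eigenvalues are at most \<open>c\<^sub>h\<close> in absolute value, hence of squared Frobenius norm at most \<open>n c\<^sub>h\<^sup>2\<close>. One
  bound on exponential moments, \<open>gaussian_quadratic_form_mgf\<close>, serves both. It multiplies up along the
  independent samples (\<open>noise_sum_mgf\<close>), and Markov's inequality shows that each of the \<open>T m\<close> events
  that an entry exceeds \<open>c c_Psi \<Psi>\<close>, and also the event that \<open>\<Sum>\<^sub>t \<xi>\<^sub>t\<close> exceeds \<open>sqrt (n T) c c\<^sub>h\<close>, has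
  probability at most \<open>exp (- 2 log (2 T m/\<delta>)) \<le> \<delta>/(2 T m)\<close>. Together they have probability at most \<open>\<delta>\<close>,
  and off them the regret bound is the claim.

  The probability in the claim is meaningful because its event is measurable: the iterates are continuous
  functions of the samples, since the functional calculus on symmetric matrices is continuous
  (\<open>continuous_on_mat_fun_symmetric\<close>).
\<close>

section \<open>Orthogonal diagonalization of symmetric matrices\<close>

lemma symmetric_dot_mult:
  fixes A :: "real^'n^'n"
  assumes "transpose A = A"
  shows "(A *v x) \<bullet> y = x \<bullet> (A *v y)"
  by (metis assms dot_lmul_matrix inner_commute transpose_matrix_vector)

text \<open>
  A maximizer \<open>v\<close> of the quadratic form on the unit sphere of \<open>S\<close> is an eigenvector: moving from \<open>v\<close>
  along any \<open>w \<in> S\<close> orthogonal to \<open>v\<close> cannot increase the Rayleigh quotient to first order, so \<open>A *v v\<close>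
  is orthogonal to every such \<open>w\<close>.
\<close>

lemma symmetric_eigenvector_in_invariant_subspace:
  fixes A :: "real^'n^'n"
  assumes A: "transpose A = A" and S: "subspace S" and inv: "\<And>x. x \<in> S \<Longrightarrow> A *v x \<in> S"
    and ne: "S \<noteq> {0}"
  shows "\<exists>v\<in>S. \<exists>l. norm v = 1 \<and> A *v v = l *\<^sub>R v"
proof -
  let ?q = "\<lambda>x. x \<bullet> (A *v x)"
  have "compact (S \<inter> sphere 0 1)"
    using closed_subspace[OF S] by (simp add: closed_Int_compact)
  moreover have "S \<inter> sphere 0 1 \<noteq> {}"
  proof -
    from S ne obtain x where "x \<in> S" "x \<noteq> 0" using subspace_0 by blast
    then have "x /\<^sub>R norm x \<in> S \<inter> sphere 0 1" by (simp add: S subspace_scale)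
    then show ?thesis by blast
  qed
  moreover have "continuous_on (S \<inter> sphere 0 1) ?q"
    by (intro continuous_intros)
  ultimately obtain v where v': "v \<in> S \<inter> sphere 0 1"
    and max': "\<forall>y\<in>S \<inter> sphere 0 1. ?q y \<le> ?q v"
    using continuous_attains_sup[of "S \<inter> sphere 0 1" ?q] by blast
  from v' have v: "v \<in> S" "norm v = 1" by auto
  have max: "?q y \<le> ?q v" if "y \<in> S" "norm y = 1" for y
    using max' that by auto
  define l where "l = ?q v"
  have bound: "?q y \<le> l * (norm y)\<^sup>2" if "y \<in> S" for y
  proof (cases "y = 0")
    case False
    have "?q (y /\<^sub>R norm y) \<le> l"
      unfolding l_def using False that by (intro max) (auto simp: S subspace_scale)
    moreover have "?q (y /\<^sub>R norm y) = ?q y / (norm y)\<^sup>2"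
      by (simp add: matrix_vector_mult_scaleR power2_eq_square divide_inverse)
    ultimately show ?thesis using False by (simp add: pos_divide_le_eq)
  qed simp
  have orth: "(A *v v) \<bullet> w = 0" if w: "w \<in> S" "v \<bullet> w = 0" for w
  proof (rule ccontr)
    define p where "p = (A *v v) \<bullet> w"
    assume "(A *v v) \<bullet> w \<noteq> 0"
    then have p: "p \<noteq> 0" by (simp add: p_def)
    define K where "K = \<bar>l * (norm w)\<^sup>2 - ?q w\<bar> + 1"
    have K: "K > 0" "l * (norm w)\<^sup>2 - ?q w \<le> K" by (auto simp: K_def)
    \<comment> \<open>With this step length the first-order gain \<open>2 t p\<close> is twice the bound \<open>t\<^sup>2 K\<close> on the second-order loss.\<close>
    define t where "t = p / K"
    have tw: "v + t *\<^sub>R w \<in> S" using v w S by (simp add: subspace_add subspace_scale)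
    have "?q (v + t *\<^sub>R w) = l + 2 * t * p + t\<^sup>2 * ?q w"
      using symmetric_dot_mult[OF A, of v w]
      by (simp add: l_def p_def matrix_vector_right_distrib matrix_vector_mult_scaleR inner_add_left
          inner_add_right inner_commute power2_eq_square algebra_simps)
    moreover have "(norm (v + t *\<^sub>R w))\<^sup>2 = 1 + t\<^sup>2 * (norm w)\<^sup>2"
      unfolding power2_norm_eq_inner using v w
      by (simp add: inner_add_left inner_add_right inner_commute power2_eq_square norm_eq_1)
    ultimately have "2 * t * p \<le> t\<^sup>2 * (l * (norm w)\<^sup>2 - ?q w)"
      using bound[OF tw] by (simp add: algebra_simps)
    also have "\<dots> \<le> t\<^sup>2 * K" by (intro mult_left_mono K) auto
    finally have "2 * (p\<^sup>2 / K) \<le> p\<^sup>2 / K"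
      using K by (simp add: t_def power2_eq_square)
    moreover have "p\<^sup>2 / K > 0" using p K by simp
    ultimately show False by linarith
  qed
  define w where "w = A *v v - l *\<^sub>R v"
  have "w \<in> S" using v S inv by (simp add: w_def subspace_diff subspace_scale)
  moreover have vw: "v \<bullet> w = 0" using v by (simp add: w_def inner_diff_right l_def norm_eq_1)
  ultimately have "(A *v v) \<bullet> w = 0" by (rule orth)
  then have "w \<bullet> w = 0" using vw by (simp add: w_def inner_diff_left inner_diff_right inner_commute)
  then have "A *v v = l *\<^sub>R v" by (simp add: w_def)
  with v show ?thesis by blast
qed

text \<open>
  Induction on the dimension: split off an eigenvector and pass to its orthogonal complement in \<open>S\<close>,
  which is invariant again by symmetry.
\<close>

lemma symmetric_orthonormal_eigenbasis:
  fixes A :: "real^'n^'n"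
  assumes A: "transpose A = A"
  shows "subspace S \<Longrightarrow> (\<And>x. x \<in> S \<Longrightarrow> A *v x \<in> S) \<Longrightarrow>
    \<exists>B. pairwise orthogonal B \<and> span B = S \<and> (\<forall>b\<in>B. norm b = 1 \<and> (\<exists>l. A *v b = l *\<^sub>R b))"
proof (induction "dim S" arbitrary: S rule: less_induct)
  case less
  show ?case
  proof (cases "S = {0}")
    case True
    then show ?thesis by (intro exI[of _ "{}"]) auto
  next
    case False
    then obtain v l where v: "v \<in> S" "norm v = 1" "A *v v = l *\<^sub>R v"
      using symmetric_eigenvector_in_invariant_subspace[OF A less.prems] by blast
    define S' where "S' = S \<inter> {w. v \<bullet> w = 0}"
    have sub': "subspace S'" unfolding S'_def
      using less.prems(1) by (auto simp: subspace_def inner_add_right)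
    have "v \<notin> S'" using v by (simp add: S'_def norm_eq_1)
    moreover have "S' \<subseteq> S" by (simp add: S'_def)
    ultimately have "S' \<subset> S" using v(1) by blast
    then have dim: "dim S' < dim S"
      using dim_psubset[of S' S] sub' less.prems(1) span_eq_iff[of S'] span_eq_iff[of S] by metis
    have inv': "A *v x \<in> S'" if "x \<in> S'" for x
      using that less.prems(2) v symmetric_dot_mult[OF A, of v x] by (auto simp: S'_def)
    obtain B where B: "pairwise orthogonal B" "span B = S'"
        "\<forall>b\<in>B. norm b = 1 \<and> (\<exists>l. A *v b = l *\<^sub>R b)"
      using less.hyps[OF dim sub' inv'] by blast
    have vB: "orthogonal v b" if "b \<in> B" for b
      using that B(2) span_base[of b B] by (auto simp: S'_def orthogonal_def)
    have "pairwise orthogonal (insert v B)"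
      using B(1) vB by (auto simp: pairwise_insert orthogonal_commute)
    moreover have "span (insert v B) = S"
    proof
      have "insert v B \<subseteq> S" using v B(2) span_superset[of B] by (auto simp: S'_def)
      then show "span (insert v B) \<subseteq> S" by (simp add: less.prems(1) span_minimal)
      show "S \<subseteq> span (insert v B)"
      proof
        fix x assume x: "x \<in> S"
        have "x - (v \<bullet> x) *\<^sub>R v \<in> S'"
          using x v less.prems(1) by (auto simp: S'_def subspace_diff subspace_scale inner_diff_right norm_eq_1)
        then show "x \<in> span (insert v B)"
          unfolding span_insert using B(2) by auto
      qed
    qed
    ultimately show ?thesis using B(3) v by (intro exI[of _ "insert v B"]) auto
  qed
qed

theorem symmetric_diagonalization:
  fixes A :: "real^'n^'n"
  assumes A: "transpose A = A"
  obtains Q d where "orthogonal_matrix Q" "A = Q ** diag_mat d ** transpose Q"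
proof -
  obtain B where B: "pairwise orthogonal B" "span B = (UNIV :: (real^'n) set)"
      "\<forall>b\<in>B. norm b = 1 \<and> (\<exists>l. A *v b = l *\<^sub>R b)"
    using symmetric_orthonormal_eigenbasis[OF A, of UNIV] by auto
  have "0 \<notin> B" using B(3) by force
  then have "independent B" using B(1) pairwise_orthogonal_independent by blast
  then have "card B = CARD('n)" "finite B"
    using B(2) by (metis dim_UNIV dim_span dim_eq_card_independent DIM_cart DIM_real mult.right_neutral,
        simp add: independent_imp_finite)
  then obtain e where e: "bij_betw e (UNIV::'n set) B"
    using finite_same_card_bij[of "UNIV::'n set" B] by auto
  define l where "l b = (SOME l. A *v b = l *\<^sub>R b)" for b
  have l: "A *v b = l b *\<^sub>R b" if "b \<in> B" for b
    unfolding l_def using B(3) that by (metis (mono_tags, lifting) someI_ex)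
  define Q :: "real^'n^'n" where "Q = (\<chi> i j. e j $ i)"
  define d :: "real^'n" where "d = (\<chi> j. l (e j))"
  have eB: "e j \<in> B" for j using e by (auto simp: bij_betw_def)
  have col: "column j Q = e j" for j by (simp add: column_def Q_def vec_eq_iff)
  have Q: "orthogonal_matrix Q"
    unfolding orthogonal_matrix_orthonormal_columns col
    using B(1,3) eB e by (metis UNIV_I bij_betw_imp_inj_on inj_onD pairwise_def)
  have "(A ** Q) $ i $ j = (Q ** diag_mat d) $ i $ j" for i j
  proof -
    have "(A ** Q) $ i $ j = (A *v e j) $ i"
      by (simp add: matrix_matrix_mult_def matrix_vector_mult_def Q_def)
    then show ?thesis by (simp add: diag_mat_mult_right l[OF eB] d_def Q_def)
  qed
  then have "A ** Q = Q ** diag_mat d" by (simp add: vec_eq_iff)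
  then have "A ** (Q ** transpose Q) = Q ** diag_mat d ** transpose Q"
    by (simp add: matrix_mul_assoc)
  then have "A = Q ** diag_mat d ** transpose Q" using Q by (simp add: orthogonal_matrix_def)
  with Q that show ?thesis by blast
qed

section \<open>Calculus of orthogonal diagonalizations\<close>

abbreviation of_spectrum :: "real^'n^'n \<Rightarrow> real^'n \<Rightarrow> real^'n^'n" where
  "of_spectrum Q d \<equiv> Q ** diag_mat d ** transpose Q"

lemma of_spectrum_nth: "of_spectrum Q d $ i $ j = (\<Sum>k\<in>UNIV. d $ k * Q $ i $ k * Q $ j $ k)"
proof -
  have "(B ** transpose Q) $ i $ j = (\<Sum>k\<in>UNIV. B $ i $ k * Q $ j $ k)" for B :: "real^'a^'a"
    by (simp add: matrix_matrix_mult_def transpose_def)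
  then show ?thesis by (simp add: diag_mat_mult_right mult_ac)
qed

lemma transpose_of_spectrum: "transpose (of_spectrum Q d) = of_spectrum Q d"
  unfolding vec_eq_iff
proof (intro allI)
  fix i j show "transpose (of_spectrum Q d) $ i $ j = of_spectrum Q d $ i $ j"
    by (subst transpose_def) (simp add: of_spectrum_nth mult_ac)
qed

lemma of_spectrum_linear:
  "of_spectrum Q c + of_spectrum Q d = of_spectrum Q (c + d)"
  "of_spectrum Q c - of_spectrum Q d = of_spectrum Q (c - d)"
  "r *\<^sub>R of_spectrum Q d = of_spectrum Q (r *\<^sub>R d)"
  by (simp_all add: vec_eq_iff of_spectrum_nth sum.distrib sum_subtractf sum_distrib_left algebra_simps)

lemma inner_of_spectrum:
  "of_spectrum Q d \<bullet> M = (\<Sum>k\<in>UNIV. d $ k * (column k Q \<bullet> (M *v column k Q)))"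
proof -
  have "of_spectrum Q d \<bullet> M = (\<Sum>i\<in>UNIV. \<Sum>j\<in>UNIV. \<Sum>k\<in>UNIV. d $ k * (Q $ i $ k * (M $ i $ j * Q $ j $ k)))"
    by (simp add: inner_vec_def of_spectrum_nth sum_distrib_left sum_distrib_right mult_ac)
  also have "\<dots> = (\<Sum>i\<in>UNIV. \<Sum>k\<in>UNIV. \<Sum>j\<in>UNIV. d $ k * (Q $ i $ k * (M $ i $ j * Q $ j $ k)))"
    by (intro sum.cong refl sum.swap)
  also have "\<dots> = (\<Sum>k\<in>UNIV. \<Sum>i\<in>UNIV. \<Sum>j\<in>UNIV. d $ k * (Q $ i $ k * (M $ i $ j * Q $ j $ k)))"
    by (rule sum.swap)
  also have "\<dots> = (\<Sum>k\<in>UNIV. d $ k * (column k Q \<bullet> (M *v column k Q)))"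
    by (simp add: inner_vec_def column_def matrix_vector_mult_def sum_distrib_left)
  finally show ?thesis .
qed

lemma quadratic_form_eq_inner_outer: "x \<bullet> (M *v x) = M \<bullet> outer x x"
  by (simp add: inner_vec_def matrix_vector_mult_def outer_def sum_distrib_left mult_ac)

lemma quadratic_form_of_spectrum:
  "x \<bullet> (of_spectrum Q d *v x) = (\<Sum>k\<in>UNIV. d $ k * (column k Q \<bullet> x)\<^sup>2)"
proof -
  have "(outer x x *v y) = (x \<bullet> y) *\<^sub>R x" for y
    by (simp add: vec_eq_iff outer_def matrix_vector_mult_def inner_vec_def sum_distrib_left mult_ac)
  then show ?thesis
    unfolding quadratic_form_eq_inner_outer
    by (simp add: inner_of_spectrum power2_eq_square inner_commute[of x])
qed

lemma orthogonal_columns_inner: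
  assumes "orthogonal_matrix (Q :: real^'n^'n)"
  shows "column i Q \<bullet> column j Q = (if i = j then 1 else 0)"
  using assms unfolding orthogonal_matrix_orthonormal_columns
  by (auto simp: norm_eq_1 orthogonal_def)

lemma of_spectrum_one:
  assumes "orthogonal_matrix (Q :: real^'n^'n)"
  shows "of_spectrum Q 1 = mat 1"
proof -
  have "diag_mat 1 = (mat 1 :: real^'n^'n)" by (simp add: diag_mat_def mat_def vec_eq_iff)
  then show ?thesis using assms by (simp add: orthogonal_matrix_def)
qed

lemma parseval_columns:
  assumes "orthogonal_matrix (Q :: real^'n^'n)"
  shows "(\<Sum>k\<in>UNIV. (column k Q \<bullet> x)\<^sup>2) = (norm x)\<^sup>2"
  using quadratic_form_of_spectrum[of x Q 1] of_spectrum_one[OF assms] by (simp add: power2_norm_eq_inner)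

lemma trace_eq_inner: "trace A = mat 1 \<bullet> (A :: real^'n^'n)"
  by (simp add: trace_def inner_vec_def mat_def if_distrib[of "\<lambda>x. x * _"] cong: if_cong)

lemma trace_mult_symmetric:
  fixes A B :: "real^'n^'n"
  assumes "transpose A = A"
  shows "trace (A ** B) = A \<bullet> B"
proof -
  have "A $ i $ j = A $ j $ i" for i j using assms by (metis transpose_def vec_lambda_beta)
  then have "trace (A ** B) = (\<Sum>i\<in>UNIV. \<Sum>j\<in>UNIV. A $ j $ i * B $ j $ i)"
    by (simp add: trace_def matrix_matrix_mult_def)
  also have "\<dots> = A \<bullet> B" by (subst sum.swap) (simp add: inner_vec_def)
  finally show ?thesis .
qed

text \<open>
  The squared overlaps of the two eigenbases form a doubly stochastic matrix when both are orthonormal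
  (\<open>parseval_columns\<close>). This is how inequalities for matrices that do not commute are reduced to scalar
  ones below.
\<close>

lemma inner_of_spectrum_of_spectrum:
  "of_spectrum Q d \<bullet> of_spectrum P c
    = (\<Sum>k\<in>UNIV. \<Sum>l\<in>UNIV. (column l P \<bullet> column k Q)\<^sup>2 * (d $ k * c $ l))"
  by (simp add: inner_of_spectrum quadratic_form_of_spectrum sum_distrib_left mult_ac)

lemma inner_of_spectrum_same:
  assumes "orthogonal_matrix (Q :: real^'n^'n)"
  shows "of_spectrum Q c \<bullet> of_spectrum Q d = (\<Sum>k\<in>UNIV. c $ k * d $ k)"
  by (simp add: inner_of_spectrum_of_spectrum orthogonal_columns_inner[OF assms]
      if_distrib[of "\<lambda>x. x\<^sup>2"] if_distrib[of "\<lambda>x. x * _"] cong: if_cong)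

lemma norm_of_spectrum_power2:
  assumes "orthogonal_matrix (Q :: real^'n^'n)"
  shows "(norm (of_spectrum Q d))\<^sup>2 = (\<Sum>k\<in>UNIV. (d $ k)\<^sup>2)"
  unfolding power2_norm_eq_inner inner_of_spectrum_same[OF assms] by (simp add: power2_eq_square)

lemma trace_of_spectrum:
  assumes "orthogonal_matrix (Q :: real^'n^'n)"
  shows "trace (of_spectrum Q d) = (\<Sum>k\<in>UNIV. d $ k)"
  using inner_of_spectrum_same[OF assms, of 1 d] of_spectrum_one[OF assms] by (simp add: trace_eq_inner)

lemma of_spectrum_mult:
  assumes "orthogonal_matrix (Q :: real^'n^'n)"
  shows "of_spectrum Q c ** of_spectrum Q d = of_spectrum Q (\<chi> i. c $ i * d $ i)"
proof -
  have "of_spectrum Q c ** of_spectrum Q d = Q ** diag_mat c ** (transpose Q ** Q) ** diag_mat d ** transpose Q"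
    by (simp add: matrix_mul_assoc)
  also have "\<dots> = Q ** (diag_mat c ** diag_mat d) ** transpose Q"
    using assms by (simp add: orthogonal_matrix_def matrix_mul_assoc)
  also have "diag_mat c ** diag_mat d = diag_mat (\<chi> i. c $ i * d $ i)"
    by (simp add: vec_eq_iff diag_mat_mult_right) (simp add: diag_mat_def)
  finally show ?thesis .
qed

lemma eigenvalue_quadratic_form:
  assumes "orthogonal_matrix (Q :: real^'n^'n)"
  shows "column k Q \<bullet> (of_spectrum Q d *v column k Q) = d $ k"
  by (simp add: quadratic_form_of_spectrum orthogonal_columns_inner[OF assms]
      if_distrib[of "\<lambda>x. x\<^sup>2"] if_distrib[of "\<lambda>x. _ * x"] cong: if_cong)

lemma one_minus_of_spectrum:
  assumes "orthogonal_matrix (Q :: real^'n^'n)"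
  shows "mat 1 - of_spectrum Q d = of_spectrum Q (1 - d)"
  using of_spectrum_one[OF assms] of_spectrum_linear(2) by metis

lemma column_nonzero:
  assumes "orthogonal_matrix (Q :: real^'n^'n)"
  shows "column k Q \<noteq> 0"
  using orthogonal_columns_inner[OF assms, of k k] by auto

lemma psd_of_spectrum:
  assumes "orthogonal_matrix (Q :: real^'n^'n)"
  shows "psd (of_spectrum Q d) \<longleftrightarrow> (\<forall>k. 0 \<le> d $ k)"
proof
  show "psd (of_spectrum Q d) \<Longrightarrow> \<forall>k. 0 \<le> d $ k"
    unfolding psd_def using eigenvalue_quadratic_form[OF assms] by metis
  show "\<forall>k. 0 \<le> d $ k \<Longrightarrow> psd (of_spectrum Q d)"
    by (simp add: psd_def transpose_of_spectrum quadratic_form_of_spectrum sum_nonneg)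
qed

lemma pd_of_spectrum:
  assumes Q: "orthogonal_matrix (Q :: real^'n^'n)"
  shows "pd (of_spectrum Q d) \<longleftrightarrow> (\<forall>k. 0 < d $ k)"
proof
  show "pd (of_spectrum Q d) \<Longrightarrow> \<forall>k. 0 < d $ k"
    unfolding pd_def using eigenvalue_quadratic_form[OF Q] column_nonzero[OF Q] by metis
next
  assume d: "\<forall>k. 0 < d $ k"
  have "0 < (\<Sum>k\<in>UNIV. d $ k * (column k Q \<bullet> x)\<^sup>2)" if x: "x \<noteq> 0" for x
  proof (rule ccontr)
    assume "\<not> ?thesis"
    moreover have nn: "0 \<le> d $ k * (column k Q \<bullet> x)\<^sup>2" for k using d by (simp add: less_imp_le)
    ultimately have "(\<Sum>k\<in>UNIV. d $ k * (column k Q \<bullet> x)\<^sup>2) = 0"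
      by (meson antisym_conv2 sum_nonneg not_less)
    then have "\<forall>k. d $ k * (column k Q \<bullet> x)\<^sup>2 = 0" using nn by (simp add: sum_nonneg_eq_0_iff)
    then have "\<forall>k. column k Q \<bullet> x = 0" using d by (metis mult_eq_0_iff less_irrefl power_eq_0_iff)
    then have "(norm x)\<^sup>2 = 0" using parseval_columns[OF Q, of x] by simp
    with x show False by simp
  qed
  then show "pd (of_spectrum Q d)" by (simp add: pd_def transpose_of_spectrum quadratic_form_of_spectrum)
qed

lemma fermi_set_of_spectrum:
  assumes "orthogonal_matrix (Q :: real^'n^'n)"
  shows "of_spectrum Q d \<in> fermi_set \<longleftrightarrow> (\<forall>k. 0 \<le> d $ k \<and> d $ k \<le> 1)"
  by (auto simp: fermi_set_def one_minus_of_spectrum[OF assms] psd_of_spectrum[OF assms])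

lemma fermi_interior_of_spectrum:
  assumes "orthogonal_matrix (Q :: real^'n^'n)"
  shows "of_spectrum Q d \<in> fermi_interior \<longleftrightarrow> (\<forall>k. 0 < d $ k \<and> d $ k < 1)"
  by (auto simp: fermi_interior_def one_minus_of_spectrum[OF assms] pd_of_spectrum[OF assms])

lemma fermi_set_diagonalization:
  assumes "Z \<in> fermi_set"
  obtains Q d where "orthogonal_matrix Q" "Z = of_spectrum Q d" "\<forall>k. 0 \<le> d $ k \<and> d $ k \<le> 1"
proof -
  have "transpose Z = Z" using assms by (simp add: fermi_set_def psd_def)
  then obtain Q d where Q: "orthogonal_matrix Q" "Z = of_spectrum Q d"
    using symmetric_diagonalization by blast
  with assms fermi_set_of_spectrum[OF Q(1), of d] that show thesis by blast
qed

section \<open>The Fermi-Dirac entropy and its Bregman divergence\<close>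

definition fermi_entropy :: "real \<Rightarrow> real" where
  "fermi_entropy x = x * ln x + (1 - x) * ln (1 - x)"

definition logistic :: "real \<Rightarrow> real" where
  "logistic x = 1 / (1 + exp (- x))"

lemma logistic_bounds: "0 < logistic x" "logistic x < 1"
  by (auto simp: logistic_def field_simps add_pos_pos)

lemma ln_odds_logistic: "ln (logistic x / (1 - logistic x)) = x"
proof -
  have "1 + exp (- x) > 0" by (simp add: add_pos_pos)
  then have "logistic x / (1 - logistic x) = exp x"
    by (simp add: logistic_def field_simps exp_minus)
  then show ?thesis by simp
qed

lemma logistic_ln_odds:
  assumes "0 < x" "x < 1"
  shows "logistic (ln (x / (1 - x))) = x"
  using assms by (simp add: logistic_def exp_minus field_simps)

lemma S_FD_of_spectrum:
  assumes "orthogonal_matrix (Q :: real^'n^'n)"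
  shows "S_FD (of_spectrum Q d) = (\<Sum>k\<in>UNIV. fermi_entropy (d $ k))"
  by (simp add: S_FD_def one_minus_of_spectrum[OF assms] mat_fun_diagonalization[OF assms]
      trace_of_spectrum[OF assms] fermi_entropy_def sum.distrib)

lemma matrix_inv_of_spectrum:
  assumes Q: "orthogonal_matrix (Q :: real^'n^'n)" and d: "\<And>k. d $ k \<noteq> 0"
  shows "matrix_inv (of_spectrum Q d) = of_spectrum Q (\<chi> k. 1 / d $ k)"
proof -
  have "(\<chi> k. d $ k * (1 / d $ k)) = 1" using d by (simp add: vec_eq_iff)
  then have right: "of_spectrum Q d ** of_spectrum Q (\<chi> k. 1 / d $ k) = mat 1"
    by (simp add: of_spectrum_mult[OF Q] of_spectrum_one[OF Q])
  moreover from right have "of_spectrum Q (\<chi> k. 1 / d $ k) ** of_spectrum Q d = mat 1"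
    by (simp add: matrix_left_right_inverse)
  ultimately have "of_spectrum Q d ** matrix_inv (of_spectrum Q d) = mat 1 \<and>
      matrix_inv (of_spectrum Q d) ** of_spectrum Q d = mat 1"
    unfolding matrix_inv_def
    using someI[of "\<lambda>B. of_spectrum Q d ** B = mat 1 \<and> B ** of_spectrum Q d = mat 1"] by blast
  then show ?thesis using right by (metis matrix_mul_assoc matrix_mul_lid matrix_mul_rid)
qed

lemma grad_S_FD_of_spectrum:
  assumes Q: "orthogonal_matrix (Q :: real^'n^'n)" and d: "\<And>k. 0 < d $ k" "\<And>k. d $ k < 1"
  shows "grad_S_FD (of_spectrum Q d) = of_spectrum Q (\<chi> k. ln (d $ k / (1 - d $ k)))"
proof -
  have "(1 - d) $ k \<noteq> 0" for k using d(2)[of k] by simp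
  then show ?thesis
    by (simp add: grad_S_FD_def one_minus_of_spectrum[OF Q] matrix_inv_of_spectrum[OF Q]
        of_spectrum_mult[OF Q] mat_fun_diagonalization[OF Q])
qed

text \<open>
  The binary Pinsker inequality. As a function of \<open>x\<close>, the difference of the two sides vanishes at
  \<open>x = a\<close> and has derivative \<open>(x - a) (1 / (x (1 - x)) - 4)\<close>, where \<open>x (1 - x) \<le> 1/4\<close>.
\<close>

lemma fermi_bregman_lower_bound_below:
  assumes "0 \<le> a" "a < x" "x < 1"
  shows "2 * (a - x)\<^sup>2 \<le> fermi_entropy a - fermi_entropy x - ln (x / (1 - x)) * (a - x)"
proof -
  define k where "k y = fermi_entropy a - a * ln y - (1 - a) * ln (1 - y) - 2 * (a - y)\<^sup>2" for y
  have ka: "k a = 0" by (simp add: k_def fermi_entropy_def)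
  have "k a \<le> k x"
  proof (rule DERIV_nonneg_imp_increasing_open[of a x k])
    show "a \<le> x" using assms by simp
  next
    fix y assume y: "a < y" "y < x"
    have "(k has_real_derivative (- a / y + (1 - a) / (1 - y) + 4 * (a - y))) (at y)"
      unfolding k_def using assms y
      by (auto intro!: derivative_eq_intros simp: divide_simps) (simp add: algebra_simps)
    moreover have "- a / y + (1 - a) / (1 - y) + 4 * (a - y) \<ge> 0"
    proof -
      have p: "0 < y * (1 - y)" using y assms by simp
      have "- a / y + (1 - a) / (1 - y) + 4 * (a - y) = (y - a) * (1 / (y * (1 - y)) - 4)"
      proof -
        have "- a / y + (1 - a) / (1 - y) = (y - a) / (y * (1 - y))"
          using y assms by (simp add: divide_simps) (simp add: algebra_simps)
        then show ?thesis by (simp add: algebra_simps)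
      qed
      moreover have "4 * (y * (1 - y)) \<le> 1"
        using zero_le_power2[of "2 * y - 1"] by (simp add: power2_eq_square algebra_simps)
      then have "4 \<le> 1 / (y * (1 - y))" by (metis p pos_le_divide_eq)
      ultimately show ?thesis using y by simp
    qed
    ultimately show "\<exists>D. (k has_real_derivative D) (at y) \<and> 0 \<le> D" by blast
  next
    \<comment> \<open>The logarithm is singular at the end point \<open>y = a\<close> only if \<open>a = 0\<close>, and then its factor vanishes.\<close>
    have 1: "continuous_on {a..x} (\<lambda>y. a * ln y)"
    proof (cases "a = 0")
      case False
      then show ?thesis using assms by (auto intro!: continuous_intros)
    qed simp
    show "continuous_on {a..x} k"
      unfolding k_def using assms by (intro continuous_intros 1) auto
  qed
  moreover have lnd: "ln (x / (1 - x)) = ln x - ln (1 - x)" using assms by (simp add: ln_div)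
  ultimately show ?thesis unfolding lnd ka by (simp add: k_def fermi_entropy_def algebra_simps)
qed

lemma fermi_entropy_reflect: "fermi_entropy (1 - x) = fermi_entropy x"
  by (simp add: fermi_entropy_def)

lemma fermi_bregman_lower_bound:
  assumes a: "0 \<le> a" "a \<le> 1" and x: "0 < x" "x < 1"
  shows "2 * (a - x)\<^sup>2 \<le> fermi_entropy a - fermi_entropy x - ln (x / (1 - x)) * (a - x)"
proof -
  consider "a < x" | "a = x" | "x < a" by linarith
  then show ?thesis
  proof cases
    case 3
    have "ln ((1 - x) / (1 - (1 - x))) = - ln (x / (1 - x))" using x by (simp add: ln_div)
    then show ?thesis
      using fermi_bregman_lower_bound_below[of "1 - a" "1 - x"] a x 3
      by (simp add: fermi_entropy_reflect power2_commute algebra_simps)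
  qed (use assms fermi_bregman_lower_bound_below in auto)
qed

text \<open>
  Expanding all traces in the eigenbases of \<open>Z\<close> and \<open>R\<close> turns both sides into averages, with the same
  doubly stochastic weights \<open>W\<close>, of the two sides of the scalar inequality. The right-hand side is the
  Bregman divergence of \<open>Z\<close> to \<open>mat_fun logistic R\<close>, written with the dual variable \<open>R\<close> in place of the
  gradient of the entropy.
\<close>

theorem S_FD_bregman_lower_bound:
  assumes Z: "Z \<in> fermi_set" and R: "transpose R = R"
  shows "2 * (norm (Z - mat_fun logistic R))\<^sup>2
    \<le> S_FD Z - S_FD (mat_fun logistic R) - R \<bullet> (Z - mat_fun logistic R)"
proof -
  obtain P a where P: "orthogonal_matrix P" "Z = of_spectrum P a"
    and a: "\<forall>k. 0 \<le> a $ k \<and> a $ k \<le> 1"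
    by (rule fermi_set_diagonalization[OF Z])
  obtain Q r where Q: "orthogonal_matrix Q" "R = of_spectrum Q r"
    by (rule symmetric_diagonalization[OF R])
  define x where "x = (\<chi> k. logistic (r $ k))"
  define X where "X = mat_fun logistic R"
  have X: "X = of_spectrum Q x" by (simp add: X_def Q(2) x_def mat_fun_diagonalization[OF Q(1)])
  define W where "W k l = (column l P \<bullet> column k Q)\<^sup>2" for k l
  have W0: "W k l \<ge> 0" for k l by (simp add: W_def)
  have W1: "(\<Sum>l\<in>UNIV. W k l) = 1" for k
    using parseval_columns[OF P(1), of "column k Q"] orthogonal_columns_inner[OF Q(1), of k k]
    by (simp add: W_def power2_norm_eq_inner)
  have W2: "(\<Sum>k\<in>UNIV. W k l) = 1" for l
  proof -
    have "W k l = (column k Q \<bullet> column l P)\<^sup>2" for k by (simp add: W_def inner_commute)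
    then show ?thesis
      using parseval_columns[OF Q(1), of "column l P"] orthogonal_columns_inner[OF P(1), of l l]
      by (simp add: power2_norm_eq_inner)
  qed
  have row: "(\<Sum>k\<in>UNIV. \<Sum>l\<in>UNIV. W k l * f k) = (\<Sum>k\<in>UNIV. f k)" for f
    by (simp add: W1 flip: sum_distrib_right)
  have col: "(\<Sum>k\<in>UNIV. \<Sum>l\<in>UNIV. W k l * f l) = (\<Sum>l\<in>UNIV. f l)" for f
    by (subst sum.swap) (simp add: W2 flip: sum_distrib_right)
  have SZ: "S_FD Z = (\<Sum>k\<in>UNIV. \<Sum>l\<in>UNIV. W k l * fermi_entropy (a $ l))"
    by (simp add: col P S_FD_of_spectrum)
  have SX: "S_FD X = (\<Sum>k\<in>UNIV. \<Sum>l\<in>UNIV. W k l * fermi_entropy (x $ k))"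
    by (simp add: row X S_FD_of_spectrum[OF Q(1)])
  have RZ: "R \<bullet> Z = (\<Sum>k\<in>UNIV. \<Sum>l\<in>UNIV. W k l * (r $ k * a $ l))"
    by (simp add: P(2) Q(2) inner_of_spectrum_of_spectrum W_def)
  have RX: "R \<bullet> X = (\<Sum>k\<in>UNIV. \<Sum>l\<in>UNIV. W k l * (r $ k * x $ k))"
    by (simp add: row Q(2) X inner_of_spectrum_same[OF Q(1)])
  have "(norm (Z - X))\<^sup>2 = Z \<bullet> Z - 2 * (X \<bullet> Z) + X \<bullet> X"
    unfolding power2_norm_eq_inner by (simp add: inner_diff_left inner_diff_right inner_commute)
  also have "Z \<bullet> Z = (\<Sum>k\<in>UNIV. \<Sum>l\<in>UNIV. W k l * (a $ l * a $ l))"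
    by (simp add: col P inner_of_spectrum_same)
  also have "X \<bullet> X = (\<Sum>k\<in>UNIV. \<Sum>l\<in>UNIV. W k l * (x $ k * x $ k))"
    by (simp add: row X inner_of_spectrum_same[OF Q(1)])
  also have "X \<bullet> Z = (\<Sum>k\<in>UNIV. \<Sum>l\<in>UNIV. W k l * (x $ k * a $ l))"
    by (simp add: P(2) X inner_of_spectrum_of_spectrum W_def)
  also have "(\<Sum>k\<in>UNIV. \<Sum>l\<in>UNIV. W k l * (a $ l * a $ l)) - 2 * (\<Sum>k\<in>UNIV. \<Sum>l\<in>UNIV. W k l * (x $ k * a $ l))
      + (\<Sum>k\<in>UNIV. \<Sum>l\<in>UNIV. W k l * (x $ k * x $ k))
    = (\<Sum>k\<in>UNIV. \<Sum>l\<in>UNIV. W k l * (a $ l * a $ l) - 2 * (W k l * (x $ k * a $ l)) + W k l * (x $ k * x $ k))"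
    by (simp only: sum.distrib sum_subtractf sum_distrib_left)
  also have "\<dots> = (\<Sum>k\<in>UNIV. \<Sum>l\<in>UNIV. W k l * (a $ l - x $ k)\<^sup>2)"
    by (intro sum.cong refl) (simp add: algebra_simps power2_eq_square)
  finally have "2 * (norm (Z - X))\<^sup>2 = (\<Sum>k\<in>UNIV. \<Sum>l\<in>UNIV. W k l * (2 * (a $ l - x $ k)\<^sup>2))"
    by (simp add: sum_distrib_left mult_ac)
  also have "\<dots> \<le> (\<Sum>k\<in>UNIV. \<Sum>l\<in>UNIV. W k l *
      (fermi_entropy (a $ l) - fermi_entropy (x $ k) - r $ k * (a $ l - x $ k)))"
  proof (intro sum_mono mult_left_mono W0)
    fix k l
    show "2 * (a $ l - x $ k)\<^sup>2 \<le> fermi_entropy (a $ l) - fermi_entropy (x $ k) - r $ k * (a $ l - x $ k)"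
      using fermi_bregman_lower_bound[of "a $ l" "x $ k"] a logistic_bounds[of "r $ k"] ln_odds_logistic[of "r $ k"]
      by (simp add: x_def)
  qed
  also have "\<dots> = (\<Sum>k\<in>UNIV. \<Sum>l\<in>UNIV. W k l * fermi_entropy (a $ l) - W k l * fermi_entropy (x $ k)
      - (W k l * (r $ k * a $ l) - W k l * (r $ k * x $ k)))"
    by (intro sum.cong refl) (simp add: algebra_simps)
  also have "\<dots> = S_FD Z - S_FD X - R \<bullet> (Z - X)"
    unfolding inner_diff_right SZ SX RZ RX by (simp only: sum_subtractf)
  finally show ?thesis by (simp add: X_def)
qed

lemma grad_S_FD_logistic:
  fixes Y :: "real^'n^'n"
  assumes "transpose Y = Y"
  shows "grad_S_FD (mat_fun logistic Y) = Y"
proof -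
  obtain Q d where Q: "orthogonal_matrix Q" "Y = of_spectrum Q d"
    by (rule symmetric_diagonalization[OF assms])
  have "grad_S_FD (of_spectrum Q (\<chi> k. logistic (d $ k))) = of_spectrum Q d"
    by (subst grad_S_FD_of_spectrum[OF Q(1)]) (simp_all add: logistic_bounds ln_odds_logistic)
  then show ?thesis by (simp add: Q(2) mat_fun_diagonalization[OF Q(1)])
qed

lemma logistic_grad_S_FD:
  fixes X :: "real^'n^'n"
  assumes "X \<in> fermi_interior"
  shows "mat_fun logistic (grad_S_FD X) = X"
proof -
  have "transpose X = X" using assms by (simp add: fermi_interior_def pd_def)
  then obtain Q d where Q: "orthogonal_matrix Q" "X = of_spectrum Q d"
    by (rule symmetric_diagonalization)
  have d: "0 < d $ k" "d $ k < 1" for k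
    using assms fermi_interior_of_spectrum[OF Q(1)] by (auto simp: Q(2))
  then show ?thesis
    by (simp add: Q(2) grad_S_FD_of_spectrum[OF Q(1)] mat_fun_diagonalization[OF Q(1)] logistic_ln_odds)
qed

lemma logistic_in_fermi_set:
  fixes Y :: "real^'n^'n"
  assumes "transpose Y = Y"
  shows "mat_fun logistic Y \<in> fermi_set"
proof -
  obtain Q d where Q: "orthogonal_matrix Q" "Y = of_spectrum Q d"
    by (rule symmetric_diagonalization[OF assms])
  then show ?thesis
    using logistic_bounds by (simp add: mat_fun_diagonalization[OF Q(1)] fermi_set_of_spectrum[OF Q(1)] less_imp_le)
qed

lemma logistic_zero: "mat_fun logistic (0 :: real^'n^'n) = (1/2) *\<^sub>R mat 1"
proof -
  have "0 = of_spectrum (mat 1 :: real^'n^'n) 0"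
    by (simp add: vec_eq_iff diag_mat_def)
  then have "mat_fun logistic (0 :: real^'n^'n) = of_spectrum (mat 1) (\<chi> k. logistic (0 $ k))"
    by (metis mat_fun_diagonalization orthogonal_matrix_id)
  also have "(\<chi> k. logistic ((0 :: real^'n) $ k)) = (1/2) *\<^sub>R 1"
    by (simp add: vec_eq_iff logistic_def)
  finally show ?thesis
    by (metis of_spectrum_linear(3) of_spectrum_one orthogonal_matrix_id)
qed

lemma S_FD_half: "S_FD ((1/2) *\<^sub>R mat 1 :: real^'n^'n) = - real CARD('n) * ln 2"
proof -
  have "S_FD ((1/2) *\<^sub>R mat 1 :: real^'n^'n) = (\<Sum>k\<in>(UNIV::'n set). fermi_entropy (((1/2) *\<^sub>R 1) $ k))"
    by (metis S_FD_of_spectrum of_spectrum_linear(3) of_spectrum_one orthogonal_matrix_id)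
  then show ?thesis by (simp add: fermi_entropy_def ln_div)
qed

lemma S_FD_nonpos:
  assumes "Z \<in> fermi_set"
  shows "S_FD Z \<le> 0"
proof -
  obtain Q d where Q: "orthogonal_matrix Q" "Z = of_spectrum Q d" and d: "\<forall>k. 0 \<le> d $ k \<and> d $ k \<le> 1"
    by (rule fermi_set_diagonalization[OF assms])
  have "x * ln x \<le> 0" if "0 \<le> x" "x \<le> 1" for x :: real
    using that by (cases "x = 0") (auto intro: mult_nonneg_nonpos)
  then have "fermi_entropy (d $ k) \<le> 0" for k
    using d[rule_format, of k] unfolding fermi_entropy_def by (intro add_nonpos_nonpos) auto
  then show ?thesis by (simp add: Q S_FD_of_spectrum sum_nonpos)
qed

section \<open>The iteration in dual variables\<close>

lemma beta_inv_nonneg: "0 < \<beta> \<Longrightarrow> 0 \<le> beta_inv \<beta>"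
  by (cases \<beta>) (auto simp: beta_inv_def)

lemma step_size_eq:
  assumes "0 < \<beta>" "0 < \<eta>"
  shows "step_size \<beta> \<eta> = 1 / (1 / \<eta> + beta_inv \<beta>)"
  using assms by (cases \<beta>) (auto simp: step_size_def beta_inv_def field_simps)

text \<open>
  The solution \<open>Y'\<close> of \<open>(1 / \<eta> + b) Y' = Y / \<eta> - G\<close>, the optimality condition of the proximal problem.
\<close>

definition dual_step :: "real \<Rightarrow> real \<Rightarrow> real^'n^'n \<Rightarrow> real^'n^'n \<Rightarrow> real^'n^'n" where
  "dual_step b \<eta> Y G = (1 / (1 / \<eta> + b)) *\<^sub>R ((1 / \<eta>) *\<^sub>R Y - G)"

lemma transpose_diff_scaleR:
  "transpose (A - B) = transpose A - transpose (B :: real^'n^'m)"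
  "transpose (r *\<^sub>R A) = r *\<^sub>R transpose (A :: real^'n^'m)"
  by (simp_all add: transpose_def vec_eq_iff)

lemma transpose_dual_step:
  assumes "transpose Y = Y" "transpose G = G"
  shows "transpose (dual_step b \<eta> Y G) = dual_step b \<eta> Y G"
  using assms by (simp add: dual_step_def transpose_diff_scaleR)

text \<open>
  With \<open>k = 1 / \<eta> + beta_inv \<beta>\<close>, the step size is \<open>1 / k\<close> and the factor \<open>1 - beta_inv \<beta> / k\<close> in the mirror
  step is \<open>1 / (k \<eta>)\<close>.
\<close>

lemma mirror_step_dual:
  fixes Y G :: "real^'n^'n"
  assumes Y: "transpose Y = Y" and pos: "0 < \<beta>" "0 < \<eta>"
    and step: "mirror_step \<beta> \<mu> (step_size \<beta> \<eta>) G (mat_fun logistic Y) X'"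
  shows "X' = mat_fun logistic (dual_step (beta_inv \<beta>) \<eta> Y (G - \<mu> *\<^sub>R mat 1))"
proof -
  define k where "k = 1 / \<eta> + beta_inv \<beta>"
  have k: "k > 0" using pos beta_inv_nonneg[OF pos(1)] by (simp add: k_def add_pos_nonneg)
  have g: "step_size \<beta> \<eta> = 1 / k" by (simp add: step_size_eq[OF pos] k_def)
  have c: "1 - beta_inv \<beta> * (1 / k) = (1 / k) * (1 / \<eta>)"
  proof -
    have "(1 / k) * (1 / \<eta>) + beta_inv \<beta> * (1 / k) = (1 / \<eta> + beta_inv \<beta>) * (1 / k)"
      by (simp only: distrib_right mult.commute[of "1 / k"])
    also have "\<dots> = 1" unfolding k_def[symmetric] using k by simp
    finally show ?thesis by simp
  qed
  have "grad_S_FD X' = dual_step (beta_inv \<beta>) \<eta> Y (G - \<mu> *\<^sub>R mat 1)"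
    using step unfolding mirror_step_def grad_S_FD_logistic[OF Y] g c dual_step_def k_def[symmetric]
    by (simp only: scaleR_diff_right scaleR_scaleR)
  moreover have "X' \<in> fermi_interior" using step by (simp add: mirror_step_def)
  ultimately show ?thesis using logistic_grad_S_FD by metis
qed

text \<open>
  The proximal objective is \<open>k (S_FD W - R \<bullet> W)\<close> plus a constant, where \<open>R\<close> is the new dual variable.
  The lower bound on the Bregman divergence makes \<open>mat_fun logistic R\<close> its only minimizer.
\<close>

lemma proximal_step_dual:
  fixes Y G :: "real^'n^'n"
  assumes Y: "transpose Y = Y" and G: "transpose G = G" and pos: "0 < \<beta>" "0 < \<eta>"
    and step: "proximal_step \<Psi> V C \<beta> \<mu> \<eta> G (mat_fun logistic Y) X'"
  shows "X' = mat_fun logistic (dual_step (beta_inv \<beta>) \<eta> Y (G - \<mu> *\<^sub>R mat 1))"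
proof -
  define k where "k = 1 / \<eta> + beta_inv \<beta>"
  have k: "k > 0" using pos beta_inv_nonneg[OF pos(1)] by (simp add: k_def add_pos_nonneg)
  define G' where "G' = G - \<mu> *\<^sub>R mat 1"
  have G': "transpose G' = G'" by (simp add: G'_def transpose_diff_scaleR G)
  define R where "R = dual_step (beta_inv \<beta>) \<eta> Y G'"
  have R: "transpose R = R" unfolding R_def by (rule transpose_dual_step[OF Y G'])
  have kR: "k *\<^sub>R R = (1 / \<eta>) *\<^sub>R Y - G'" using k by (simp add: R_def dual_step_def k_def)
  define X where "X = mat_fun logistic Y"
  let ?f = "\<lambda>Y. energy \<Psi> V C X + G' \<bullet> (Y - X) + beta_inv \<beta> * S_FD Y + inverse \<eta> * bregman_FD Y X"
  have f: "?f W = k * (S_FD W - R \<bullet> W) + (energy \<Psi> V C X - G' \<bullet> X - (1 / \<eta>) * (S_FD X - Y \<bullet> X))" for W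
  proof -
    have "k * (R \<bullet> W) = (1 / \<eta>) * (Y \<bullet> W) - G' \<bullet> W"
      using arg_cong[OF kR, of "\<lambda>M. M \<bullet> W"] by (simp add: inner_diff_left)
    moreover have "bregman_FD W X = S_FD W - S_FD X - (Y \<bullet> W - Y \<bullet> X)"
      by (simp add: bregman_FD_def X_def grad_S_FD_logistic[OF Y] inner_diff_right)
    ultimately show ?thesis
      by (simp add: k_def distrib_right right_diff_distrib inner_diff_right inverse_eq_divide
          add_divide_distrib diff_divide_distrib)
  qed
  have min: "X' \<in> fermi_set" "\<And>W. W \<in> fermi_set \<Longrightarrow> ?f X' \<le> ?f W"
    using step unfolding proximal_step_def is_arg_min_linorder X_def[symmetric] G'_def[symmetric] by auto
  have "?f X' \<le> ?f (mat_fun logistic R)" by (intro min logistic_in_fermi_set R)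
  then have "S_FD X' - R \<bullet> X' \<le> S_FD (mat_fun logistic R) - R \<bullet> mat_fun logistic R"
    using k unfolding f by simp
  with S_FD_bregman_lower_bound[OF min(1) R]
  have "(norm (X' - mat_fun logistic R))\<^sup>2 \<le> 0" unfolding inner_diff_right by linarith
  then have "X' = mat_fun logistic R" by (simp add: power2_less_eq_zero_iff)
  then show ?thesis by (simp add: R_def G'_def)
qed

lemma transpose_congruence_diag:
  fixes \<Psi> :: "real^'n^'m"
  shows "transpose (transpose \<Psi> ** diag_mat v ** \<Psi>) = transpose \<Psi> ** diag_mat v ** \<Psi>"
proof -
  have "transpose (diag_mat v) = diag_mat v"
    by (auto simp: transpose_def diag_mat_def vec_eq_iff)
  then show ?thesis by (simp add: matrix_transpose_mul transpose_transpose matrix_mul_assoc)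
qed

lemma transpose_grad_E_tilde: "transpose (grad_E_tilde \<Psi> V Y) = grad_E_tilde \<Psi> V Y"
  unfolding grad_E_tilde_def by (rule transpose_congruence_diag)

lemma transpose_stoch_grad:
  assumes "transpose C = C"
  shows "transpose (stoch_grad \<Psi> V C X z) = stoch_grad \<Psi> V C X z"
  using assms transpose_grad_E_tilde[of \<Psi> V]
  by (simp add: stoch_grad_def) (simp add: transpose_def vec_eq_iff)

text \<open>
  The dual variables as a function of the sample sequence alone; only the first \<open>t\<close> samples enter the
  \<open>t\<close>-th one (\<open>dual_iterate_cong\<close>).
\<close>

fun dual_iterate :: "real^'n^'m \<Rightarrow> real^'m^'m \<Rightarrow> real^'n^'n \<Rightarrow> real \<Rightarrow> real \<Rightarrow> real \<Rightarrow> (nat \<Rightarrow> real^'n) \<Rightarrow> nat \<Rightarrow> real^'n^'n" where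
  "dual_iterate \<Psi> V C \<mu> b \<eta> z 0 = 0"
| "dual_iterate \<Psi> V C \<mu> b \<eta> z (Suc t) = (let Y = dual_iterate \<Psi> V C \<mu> b \<eta> z t in
     dual_step b \<eta> Y (stoch_grad \<Psi> V C (mat_fun logistic Y) (z t) - \<mu> *\<^sub>R mat 1))"

lemma transpose_dual_iterate:
  assumes "transpose C = C"
  shows "transpose (dual_iterate \<Psi> V C \<mu> b \<eta> z t) = dual_iterate \<Psi> V C \<mu> b \<eta> z t"
proof (induction t)
  case 0 show ?case by (simp add: transpose_def vec_eq_iff)
next
  case (Suc t) then show ?case
    by (simp add: Let_def transpose_dual_step transpose_diff_scaleR transpose_stoch_grad assms)
qed

lemma iterate_eq_logistic_dual_iterate:
  fixes C :: "real^'n^'n" and \<Psi> :: "real^'n^'m"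
  assumes C: "transpose C = C" and pos: "0 < \<beta>" "0 < \<eta>"
    and X0: "X 0 = (1/2) *\<^sub>R mat 1"
    and step: "\<And>t. t < T \<Longrightarrow>
        mirror_step \<beta> \<mu> (step_size \<beta> \<eta>) (stoch_grad \<Psi> V C (X t) (z t)) (X t) (X (Suc t))
      \<or> proximal_step \<Psi> V C \<beta> \<mu> \<eta> (stoch_grad \<Psi> V C (X t) (z t)) (X t) (X (Suc t))"
  shows "t \<le> T \<Longrightarrow> X t = mat_fun logistic (dual_iterate \<Psi> V C \<mu> (beta_inv \<beta>) \<eta> z t)"
proof (induction t)
  case 0 show ?case by (simp add: X0 logistic_zero)
next
  case (Suc t)
  let ?Y = "dual_iterate \<Psi> V C \<mu> (beta_inv \<beta>) \<eta> z t"
  have Y: "transpose ?Y = ?Y" by (rule transpose_dual_iterate[OF C])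
  have "X t = mat_fun logistic ?Y" using Suc by simp
  with step[of t] Suc.prems have "mirror_step \<beta> \<mu> (step_size \<beta> \<eta>) (stoch_grad \<Psi> V C (X t) (z t)) (mat_fun logistic ?Y) (X (Suc t))
      \<or> proximal_step \<Psi> V C \<beta> \<mu> \<eta> (stoch_grad \<Psi> V C (X t) (z t)) (mat_fun logistic ?Y) (X (Suc t))"
    by simp
  then show ?case
    using mirror_step_dual[OF Y pos] proximal_step_dual[OF Y transpose_stoch_grad[OF C] pos] \<open>X t = _\<close>
    by (auto simp: Let_def)
qed

section \<open>Bounds on densities and gradients\<close>

lemma norm_le_of_quadratic_form_bound:
  fixes A :: "real^'n^'n"
  assumes A: "transpose A = A" and bound: "\<And>x. \<bar>x \<bullet> (A *v x)\<bar> \<le> b * (norm x)\<^sup>2"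
  shows "(norm A)\<^sup>2 \<le> real CARD('n) * b\<^sup>2"
proof -
  obtain Q d where Q: "orthogonal_matrix Q" "A = of_spectrum Q d"
    by (rule symmetric_diagonalization[OF A])
  have "(d $ k)\<^sup>2 \<le> b\<^sup>2" for k
  proof -
    have "\<bar>d $ k\<bar> \<le> b"
      using bound[of "column k Q"] orthogonal_columns_inner[OF Q(1), of k k]
      by (simp add: Q(2) eigenvalue_quadratic_form[OF Q(1)] power2_norm_eq_inner)
    then show ?thesis by (metis abs_ge_zero power2_abs power_mono)
  qed
  then have "(\<Sum>k\<in>UNIV. (d $ k)\<^sup>2) \<le> (\<Sum>k\<in>(UNIV::'n set). b\<^sup>2)" by (rule sum_mono)
  then show ?thesis by (simp add: Q(2) norm_of_spectrum_power2[OF Q(1)])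
qed

lemma dot_vector_matrix_mult:
  fixes A :: "real^'n^'m"
  shows "x \<bullet> (y v* A) = (A *v x) \<bullet> y"
  by (metis dot_lmul_matrix inner_commute)

lemma quadratic_form_congruence_diag:
  fixes \<Psi> :: "real^'n^'m"
  shows "x \<bullet> ((transpose \<Psi> ** diag_mat v ** \<Psi>) *v x) = (\<Sum>p\<in>UNIV. v $ p * ((\<Psi> *v x) $ p)\<^sup>2)"
proof -
  have "diag_mat v *v y = (\<chi> p. v $ p * y $ p)" for y :: "real^'m"
    by (simp add: vec_eq_iff matrix_vector_mult_def diag_mat_def if_distrib[of "\<lambda>x. x * _"] cong: if_cong)
  then have "x \<bullet> ((transpose \<Psi> ** diag_mat v ** \<Psi>) *v x) = (\<Psi> *v x) \<bullet> (\<chi> p. v $ p * (\<Psi> *v x) $ p)"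
    by (simp add: dot_vector_matrix_mult flip: matrix_vector_mul_assoc)
  then show ?thesis by (simp add: inner_vec_def power2_eq_square mult_ac)
qed

lemma isometry_norm:
  fixes \<Psi> :: "real^'n^'m"
  assumes "transpose \<Psi> ** \<Psi> = mat 1"
  shows "(norm (\<Psi> *v x))\<^sup>2 = (norm x)\<^sup>2"
proof -
  have "(\<Psi> *v x) \<bullet> (\<Psi> *v x) = x \<bullet> ((transpose \<Psi> ** \<Psi>) *v x)"
    by (simp add: dot_vector_matrix_mult flip: matrix_vector_mul_assoc)
  then show ?thesis by (simp add: assms power2_norm_eq_inner)
qed

text \<open>
  Compressing a diagonal matrix by an isometry does not increase its spectral norm. This bounds both the
  gradient of the energy and the matrix of the noise.
\<close>

lemma quadratic_form_congruence_bound: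
  fixes \<Psi> :: "real^'n^'m"
  assumes "transpose \<Psi> ** \<Psi> = mat 1" and v: "\<And>p. \<bar>v $ p\<bar> \<le> b"
  shows "\<bar>x \<bullet> ((transpose \<Psi> ** diag_mat v ** \<Psi>) *v x)\<bar> \<le> b * (norm x)\<^sup>2"
proof -
  have "\<bar>\<Sum>p\<in>UNIV. v $ p * ((\<Psi> *v x) $ p)\<^sup>2\<bar> \<le> (\<Sum>p\<in>UNIV. \<bar>v $ p * ((\<Psi> *v x) $ p)\<^sup>2\<bar>)"
    by (rule sum_abs)
  also have "\<dots> \<le> (\<Sum>p\<in>UNIV. b * ((\<Psi> *v x) $ p)\<^sup>2)"
    by (intro sum_mono) (simp add: abs_mult mult_right_mono v)
  also have "\<dots> = b * (norm (\<Psi> *v x))\<^sup>2"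
    unfolding power2_norm_eq_inner by (simp add: inner_vec_def sum_distrib_left power2_eq_square)
  finally show ?thesis by (simp add: isometry_norm[OF assms(1)] quadratic_form_congruence_diag)
qed

lemma abs_mult_vec_le_norm_inf:
  fixes V :: "real^'m^'m"
  assumes "\<And>q. \<bar>v $ q\<bar> \<le> b"
  shows "\<bar>(V *v v) $ p\<bar> \<le> norm_inf V * b"
proof -
  have "0 \<le> b" using assms[of p] by linarith
  have "\<bar>(V *v v) $ p\<bar> \<le> (\<Sum>j\<in>UNIV. \<bar>V $ p $ j * v $ j\<bar>)"
    unfolding matrix_vector_mult_def by simp
  also have "\<dots> \<le> (\<Sum>j\<in>UNIV. \<bar>V $ p $ j\<bar> * b)"
    by (intro sum_mono) (simp add: abs_mult mult_left_mono assms)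
  also have "\<dots> = (\<Sum>j\<in>UNIV. \<bar>V $ p $ j\<bar>) * b" by (simp add: sum_distrib_right)
  also have "\<dots> \<le> norm_inf V * b"
    unfolding norm_inf_def using \<open>0 \<le> b\<close> by (intro mult_right_mono Max_ge) auto
  finally show ?thesis .
qed

lemma row_norm_le_c_Psi: "(norm (\<Psi> $ p))\<^sup>2 \<le> c_Psi \<Psi>"
proof -
  have "(norm (\<Psi> $ p))\<^sup>2 = (\<Sum>i\<in>UNIV. \<bar>\<Psi> $ p $ i\<bar>\<^sup>2)"
    unfolding power2_norm_eq_inner by (simp add: inner_vec_def power2_eq_square)
  also have "\<dots> \<le> c_Psi \<Psi>" unfolding c_Psi_def by (intro Max_ge) auto
  finally show ?thesis .
qed

lemma rho_nth_quadratic_form: "rho \<Psi> Y $ p = \<Psi> $ p \<bullet> (Y *v \<Psi> $ p)"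
proof -
  have "rho \<Psi> Y $ p = (\<Sum>i\<in>UNIV. \<Sum>j\<in>UNIV. \<Psi> $ p $ i * Y $ i $ j * \<Psi> $ p $ j)"
    unfolding rho_nth by (rule sum.swap)
  then show ?thesis by (simp add: inner_vec_def matrix_vector_mult_def sum_distrib_left mult_ac)
qed

lemma fermi_set_quadratic_form:
  assumes "X \<in> fermi_set"
  shows "0 \<le> x \<bullet> (X *v x)" "x \<bullet> (X *v x) \<le> (norm x)\<^sup>2"
proof -
  show "0 \<le> x \<bullet> (X *v x)" using assms by (simp add: fermi_set_def psd_def)
  have "0 \<le> x \<bullet> ((mat 1 - X) *v x)" using assms by (simp add: fermi_set_def psd_def)
  then show "x \<bullet> (X *v x) \<le> (norm x)\<^sup>2"
    by (simp add: matrix_vector_mult_diff_rdistrib inner_diff_right power2_norm_eq_inner)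
qed

lemma rho_fermi_set:
  assumes "X \<in> fermi_set"
  shows "0 \<le> rho \<Psi> X $ p" "rho \<Psi> X $ p \<le> c_Psi \<Psi>"
  using fermi_set_quadratic_form[OF assms, of "\<Psi> $ p"] row_norm_le_c_Psi[of \<Psi> p]
  by (auto simp: rho_nth_quadratic_form)

lemma rho_diff: "rho \<Psi> (X - Y) = rho \<Psi> X - rho \<Psi> Y"
  by (simp add: vec_eq_iff rho_nth sum_subtractf algebra_simps)

lemma inner_grad_E_tilde: "grad_E_tilde \<Psi> V Y \<bullet> H = (V *v rho \<Psi> Y) \<bullet> rho \<Psi> H"
  by (simp add: grad_E_tilde_def rho_inner)

text \<open>
  A quadratic function lies above its tangent; the defect is half the form of \<open>V\<close> at
  \<open>rho \<Psi> X - rho \<Psi> Z\<close>.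
\<close>

lemma E_tilde_convex:
  assumes "psd V"
  shows "E_tilde \<Psi> V X - E_tilde \<Psi> V Z \<le> grad_E_tilde \<Psi> V X \<bullet> (X - Z)"
proof -
  define v w where "v = rho \<Psi> X" and "w = rho \<Psi> Z"
  have sym: "w \<bullet> (V *v v) = v \<bullet> (V *v w)"
    using symmetric_dot_mult[of V v w] assms by (simp add: psd_def inner_commute)
  have "0 \<le> (v - w) \<bullet> (V *v (v - w))" using assms by (simp add: psd_def)
  then have "0 \<le> v \<bullet> (V *v v) - 2 * (w \<bullet> (V *v v)) + w \<bullet> (V *v w)"
    using sym by (simp add: matrix_vector_mult_diff_distrib inner_diff_left inner_diff_right)
  then show ?thesis
    by (simp add: E_tilde_def inner_grad_E_tilde rho_diff v_def[symmetric] w_def[symmetric] inner_diff_right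
        inner_commute[of "V *v v"] field_simps)
qed

section \<open>Regret of mirror descent\<close>

text \<open>
  The Bregman divergence of \<open>Z\<close> to \<open>mat_fun logistic Y\<close>, as a function of the dual variable \<open>Y\<close> of its
  second argument.
\<close>

definition bregman_dual :: "real^'n^'n \<Rightarrow> real^'n^'n \<Rightarrow> real" where
  "bregman_dual Z Y = S_FD Z - S_FD (mat_fun logistic Y) - Y \<bullet> (Z - mat_fun logistic Y)"

text \<open>
  Solving the step equation for \<open>G\<close> gives
  \<open>G \<bullet> (X' - Z) = (1 / \<eta>) (Y - Y') \<bullet> (X' - Z) - b Y' \<bullet> (X' - Z)\<close>. The three-point identity for Bregman
  divergences rewrites the first term, the definition of the divergence the second. The divergence of
  \<open>X'\<close> to \<open>X\<close> is kept through its quadratic lower bound, to absorb the gradient later.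
\<close>

lemma mirror_descent_one_step:
  fixes Y G Z :: "real^'n^'n"
  assumes Y: "transpose Y = Y" and G: "transpose G = G" and Z: "Z \<in> fermi_set"
    and pos: "0 < \<eta>" "0 \<le> b"
  defines "Y' \<equiv> dual_step b \<eta> Y G"
  defines "X \<equiv> mat_fun logistic Y" and "X' \<equiv> mat_fun logistic Y'"
  shows "G \<bullet> (X' - Z) + b * (S_FD X' - S_FD Z)
    \<le> (1 / \<eta>) * (bregman_dual Z Y - bregman_dual Z Y') - (2 / \<eta>) * (norm (X' - X))\<^sup>2"
proof -
  define k where "k = 1 / \<eta> + b"
  have k: "k > 0" using pos by (simp add: k_def add_pos_nonneg)
  have Y': "transpose Y' = Y'" unfolding Y'_def by (rule transpose_dual_step[OF Y G])
  have "k *\<^sub>R Y' = (1 / \<eta>) *\<^sub>R Y - G" using k by (simp add: Y'_def dual_step_def k_def)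
  then have Geq: "G = (1 / \<eta>) *\<^sub>R Y - k *\<^sub>R Y'" by simp
  have three: "(Y - Y') \<bullet> (X' - Z) = bregman_dual Z Y - bregman_dual Z Y' - bregman_dual X' Y"
    by (simp add: bregman_dual_def X_def X'_def inner_diff_left inner_diff_right)
  have "G \<bullet> (X' - Z) = (1 / \<eta>) * ((Y - Y') \<bullet> (X' - Z)) - b * (Y' \<bullet> (X' - Z))"
    by (simp add: Geq k_def inner_diff_left algebra_simps diff_divide_distrib)
  also have "b * (Y' \<bullet> (X' - Z)) = b * (S_FD X' - S_FD Z) + b * bregman_dual Z Y'"
    by (simp add: bregman_dual_def X'_def inner_diff_right algebra_simps)
  finally have eq: "G \<bullet> (X' - Z) + b * (S_FD X' - S_FD Z)
      = (1 / \<eta>) * (bregman_dual Z Y - bregman_dual Z Y') - (1 / \<eta>) * bregman_dual X' Y - b * bregman_dual Z Y'"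
    unfolding three by (simp add: algebra_simps)
  have "2 * (norm (Z - X'))\<^sup>2 \<le> bregman_dual Z Y'"
    using S_FD_bregman_lower_bound[OF Z Y'] by (simp add: bregman_dual_def X'_def)
  then have "0 \<le> bregman_dual Z Y'" by (smt (verit) zero_le_power2)
  then have 1: "0 \<le> b * bregman_dual Z Y'" using pos by simp
  have "2 * (norm (X' - X))\<^sup>2 \<le> bregman_dual X' Y"
    using S_FD_bregman_lower_bound[OF logistic_in_fermi_set[OF Y'] Y]
    by (simp add: bregman_dual_def X'_def X_def)
  then have "(1 / \<eta>) * (2 * (norm (X' - X))\<^sup>2) \<le> (1 / \<eta>) * bregman_dual X' Y"
    using pos by (intro mult_left_mono) auto
  then show ?thesis using eq 1 by simp
qed

lemma inner_le_quadratic: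
  fixes A B :: "'a::real_inner"
  assumes "0 < \<eta>"
  shows "A \<bullet> B - (2 / \<eta>) * (norm B)\<^sup>2 \<le> \<eta> / 8 * (norm A)\<^sup>2"
proof -
  have "0 \<le> (norm (\<eta> *\<^sub>R A - 4 *\<^sub>R B))\<^sup>2 / (8 * \<eta>)" using assms by simp
  also have "(norm (\<eta> *\<^sub>R A - 4 *\<^sub>R B))\<^sup>2 = \<eta>\<^sup>2 * (norm A)\<^sup>2 - 8 * \<eta> * (A \<bullet> B) + 16 * (norm B)\<^sup>2"
    unfolding power2_norm_eq_inner
    by (simp add: inner_diff_left inner_diff_right inner_commute power2_eq_square algebra_simps)
  also have "\<dots> / (8 * \<eta>) = \<eta> / 8 * (norm A)\<^sup>2 - A \<bullet> B + (2 / \<eta>) * (norm B)\<^sup>2"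
    using assms by (simp add: field_simps power2_eq_square)
  finally show ?thesis by simp
qed

lemma inner_half_minus_fermi_set_le:
  fixes K X :: "real^'n^'n"
  assumes "X \<in> fermi_set"
  shows "K \<bullet> ((1/2) *\<^sub>R mat 1 - X) \<le> real CARD('n) * onorm ((*v) K)"
proof -
  obtain Q d where Q: "orthogonal_matrix Q" "X = of_spectrum Q d" and d: "\<forall>k. 0 \<le> d $ k \<and> d $ k \<le> 1"
    by (rule fermi_set_diagonalization[OF assms])
  define e where "e = (1/2) *\<^sub>R 1 - d"
  have "(1/2) *\<^sub>R mat 1 - X = of_spectrum Q e"
    by (metis Q(2) e_def of_spectrum_linear(2,3) of_spectrum_one[OF Q(1)])
  then have "K \<bullet> ((1/2) *\<^sub>R mat 1 - X) = (\<Sum>k\<in>UNIV. e $ k * (column k Q \<bullet> (K *v column k Q)))"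
    by (simp add: inner_of_spectrum inner_commute[of K])
  also have "\<dots> \<le> (\<Sum>k\<in>(UNIV::'n set). onorm ((*v) K))"
  proof (rule sum_mono)
    fix k
    have n1: "norm (column k Q) = 1" using orthogonal_columns_inner[OF Q(1), of k k] by (simp add: norm_eq_1)
    have "\<bar>column k Q \<bullet> (K *v column k Q)\<bar> \<le> norm (K *v column k Q)"
      using Cauchy_Schwarz_ineq2[of "column k Q" "K *v column k Q"] by (simp add: n1)
    also have "\<dots> \<le> onorm ((*v) K)"
      using onorm[of "(*v) K" "column k Q"] n1 by (simp add: matrix_vector_mul_bounded_linear)
    finally have 1: "\<bar>column k Q \<bullet> (K *v column k Q)\<bar> \<le> onorm ((*v) K)" .
    have "e $ k * (column k Q \<bullet> (K *v column k Q)) \<le> \<bar>e $ k\<bar> * \<bar>column k Q \<bullet> (K *v column k Q)\<bar>"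
      by (metis abs_ge_self abs_mult)
    also have "\<dots> \<le> 1 * onorm ((*v) K)"
      using d[rule_format, of k] by (intro mult_mono 1) (auto simp: e_def)
    finally show "e $ k * (column k Q \<bullet> (K *v column k Q)) \<le> onorm ((*v) K)" by simp
  qed
  finally show ?thesis by simp
qed

text \<open>
  The price of using the sampled gradient in place of \<open>grad_E_tilde \<Psi> V X\<close> in the convexity inequality
  with comparison point \<open>Z\<close>. For \<open>X \<in> fermi_set\<close>, its mean over a standard Gaussian \<open>z\<close> is zero.
\<close>

definition noise :: "real^'n^'m \<Rightarrow> real^'m^'m \<Rightarrow> real^'n^'n \<Rightarrow> real^'n^'n \<Rightarrow> real^'n \<Rightarrow> real" where
  "noise \<Psi> V Z X z = (grad_E_tilde \<Psi> V X - grad_E_tilde \<Psi> V (sampled_matrix X z)) \<bullet> (X - Z)"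

text \<open>
  The step bound controls \<open>G \<bullet> (X' - Z)\<close> whereas convexity asks for \<open>G \<bullet> (X - Z)\<close>. Of the difference
  \<open>G \<bullet> (X - X')\<close>, the part with \<open>C - \<mu> I\<close> telescopes and the part with \<open>H\<close> is absorbed by the quadratic
  term in \<open>X' - X\<close>.
\<close>

lemma free_energy_gap_le:
  fixes Y Z :: "real^'n^'n" and \<Psi> :: "real^'n^'m" and z :: "real^'n" and \<mu> :: real
  assumes V: "psd V" and C: "transpose C = C" and Y: "transpose Y = Y" and Z: "Z \<in> fermi_set"
    and pos: "0 < \<eta>" "0 \<le> beta_inv \<beta>"
  defines "X \<equiv> mat_fun logistic Y" and "b \<equiv> beta_inv \<beta>"
  defines "H \<equiv> grad_E_tilde \<Psi> V (sampled_matrix X z)"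
  defines "Y' \<equiv> dual_step b \<eta> Y (stoch_grad \<Psi> V C X z - \<mu> *\<^sub>R mat 1)"
  defines "X' \<equiv> mat_fun logistic Y'"
  shows "(free_energy \<Psi> V C \<beta> X - \<mu> * trace X) - (free_energy \<Psi> V C \<beta> Z - \<mu> * trace Z)
    \<le> (1 / \<eta>) * (bregman_dual Z Y - bregman_dual Z Y') + (C - \<mu> *\<^sub>R mat 1) \<bullet> (X - X')
      + b * (S_FD X - S_FD X') + noise \<Psi> V Z X z + \<eta> / 8 * (norm H)\<^sup>2"
proof -
  define G where "G = stoch_grad \<Psi> V C X z - \<mu> *\<^sub>R mat 1"
  have G: "transpose G = G"
    by (simp add: G_def transpose_diff_scaleR transpose_stoch_grad C)
  have GK: "G = (C - \<mu> *\<^sub>R mat 1) + H" by (simp add: G_def stoch_grad_def H_def)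
  have L: "free_energy \<Psi> V C \<beta> W - \<mu> * trace W = (C - \<mu> *\<^sub>R mat 1) \<bullet> W + E_tilde \<Psi> V W + b * S_FD W" for W
    by (simp add: free_energy_def energy_def trace_mult_symmetric[OF C] trace_eq_inner[of W] inner_diff_left b_def)
  have "E_tilde \<Psi> V X - E_tilde \<Psi> V Z \<le> H \<bullet> (X - Z) + noise \<Psi> V Z X z"
    using E_tilde_convex[OF V, of \<Psi> X Z] by (simp add: noise_def H_def inner_diff_left)
  then have "(free_energy \<Psi> V C \<beta> X - \<mu> * trace X) - (free_energy \<Psi> V C \<beta> Z - \<mu> * trace Z)
    \<le> G \<bullet> (X' - Z) + b * (S_FD X' - S_FD Z) + G \<bullet> (X - X') + b * (S_FD X - S_FD X') + noise \<Psi> V Z X z"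
    unfolding L GK by (simp add: inner_diff_right inner_add_left algebra_simps)
  also have "G \<bullet> (X' - Z) + b * (S_FD X' - S_FD Z)
      \<le> (1 / \<eta>) * (bregman_dual Z Y - bregman_dual Z Y') - (2 / \<eta>) * (norm (X' - X))\<^sup>2"
    using mirror_descent_one_step[OF Y G Z pos] by (simp add: X_def X'_def Y'_def G_def b_def)
  also have "G \<bullet> (X - X') = (C - \<mu> *\<^sub>R mat 1) \<bullet> (X - X') + H \<bullet> (X - X')"
    by (simp add: GK inner_add_left)
  finally show ?thesis
    using inner_le_quadratic[OF pos(1), of H "X - X'"] by (simp add: norm_minus_commute)
qed

text \<open>
  All of the one-step bound except the noise and the squared gradient is a decrement of the potential
  \<open>P\<close>. In its total decrease, the divergence and entropy terms are bounded because the entropy is nonpositive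
  and has its minimum \<open>- n ln 2\<close> at \<open>X 0 = I / 2\<close>, where the dual variable vanishes; the linear term is
  bounded because \<open>X 0 - X T\<close> has eigenvalues in \<open>[-1/2, 1/2]\<close>.
\<close>

theorem mirror_descent_regret:
  fixes \<Psi> :: "real^'n^'m" and V :: "real^'m^'m" and C Z :: "real^'n^'n" and z :: "nat \<Rightarrow> real^'n"
    and \<mu> :: real
  assumes Psi: "transpose \<Psi> ** \<Psi> = mat 1" and V: "psd V" and C: "transpose C = C" and Z: "Z \<in> fermi_set"
    and pos: "0 < \<eta>" "0 < \<beta>"
  defines "X \<equiv> \<lambda>t. mat_fun logistic (dual_iterate \<Psi> V C \<mu> (beta_inv \<beta>) \<eta> z t)"
  assumes rho_bound: "\<And>t p. t < T \<Longrightarrow> \<bar>rho \<Psi> (sampled_matrix (X t) (z t)) $ p\<bar> \<le> a"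
  shows "(\<Sum>t<T. (free_energy \<Psi> V C \<beta> (X t) - \<mu> * trace (X t)) - (free_energy \<Psi> V C \<beta> Z - \<mu> * trace Z))
    \<le> real CARD('n) * (ln 2 / \<eta> + onorm ((*v) (C - \<mu> *\<^sub>R mat 1)) + real T * (\<eta> / 8 * (norm_inf V * a)\<^sup>2))
      + (\<Sum>t<T. noise \<Psi> V Z (X t) (z t))"
proof -
  define b where "b = beta_inv \<beta>"
  have b: "0 \<le> b" using beta_inv_nonneg[OF pos(2)] by (simp add: b_def)
  define Y where "Y = dual_iterate \<Psi> V C \<mu> b \<eta> z"
  have X: "X t = mat_fun logistic (Y t)" for t by (simp add: X_def Y_def b_def)
  have Y: "transpose (Y t) = Y t" for t unfolding Y_def by (rule transpose_dual_iterate[OF C])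
  have YSuc: "Y (Suc t) = dual_step b \<eta> (Y t) (stoch_grad \<Psi> V C (X t) (z t) - \<mu> *\<^sub>R mat 1)" for t
    by (simp add: Y_def X_def b_def Let_def)
  have XF: "X t \<in> fermi_set" for t unfolding X by (rule logistic_in_fermi_set[OF Y])
  have X0: "X 0 = (1/2) *\<^sub>R mat 1" by (simp add: X Y_def logistic_zero)
  define K where "K = C - \<mu> *\<^sub>R mat 1"
  define P where "P t = bregman_dual Z (Y t) / \<eta> + K \<bullet> X t + b * S_FD (X t)" for t
  define c where "c = real CARD('n) * (\<eta> / 8 * (norm_inf V * a)\<^sup>2)"
  have "(\<Sum>t<T. (free_energy \<Psi> V C \<beta> (X t) - \<mu> * trace (X t)) - (free_energy \<Psi> V C \<beta> Z - \<mu> * trace Z))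
    \<le> (\<Sum>t<T. (P t - P (Suc t)) + noise \<Psi> V Z (X t) (z t) + c)"
  proof (rule sum_mono)
    fix t assume "t \<in> {..<T}"
    then have t: "t < T" by simp
    let ?H = "grad_E_tilde \<Psi> V (sampled_matrix (X t) (z t))"
    have "(norm ?H)\<^sup>2 \<le> real CARD('n) * (norm_inf V * a)\<^sup>2"
      using transpose_grad_E_tilde[of \<Psi> V "sampled_matrix (X t) (z t)"]
      unfolding grad_E_tilde_def
      by (intro norm_le_of_quadratic_form_bound quadratic_form_congruence_bound Psi
          abs_mult_vec_le_norm_inf rho_bound t)
    then have "\<eta> / 8 * (norm ?H)\<^sup>2 \<le> \<eta> / 8 * (real CARD('n) * (norm_inf V * a)\<^sup>2)"
      using pos by (intro mult_left_mono) auto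
    then have "\<eta> / 8 * (norm ?H)\<^sup>2 \<le> c" by (simp add: c_def mult_ac)
    with free_energy_gap_le[OF V C Y[of t] Z pos(1), where \<beta> = \<beta> and \<Psi> = \<Psi> and z = "z t" and \<mu> = \<mu>] b
    show "(free_energy \<Psi> V C \<beta> (X t) - \<mu> * trace (X t)) - (free_energy \<Psi> V C \<beta> Z - \<mu> * trace Z)
      \<le> (P t - P (Suc t)) + noise \<Psi> V Z (X t) (z t) + c"
      by (simp add: P_def b_def[symmetric] X[symmetric] YSuc[symmetric] K_def[symmetric] inner_diff_right
          diff_divide_distrib right_diff_distrib)
  qed
  also have "\<dots> = (P 0 - P T) + (\<Sum>t<T. noise \<Psi> V Z (X t) (z t)) + real T * c"
    by (simp add: sum.distrib sum_lessThan_telescope')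
  also have "P 0 - P T \<le> real CARD('n) * ln 2 / \<eta> + real CARD('n) * onorm ((*v) K)"
  proof -
    have "2 * (norm (Z - X T))\<^sup>2 \<le> bregman_dual Z (Y T)"
      using S_FD_bregman_lower_bound[OF Z Y] by (simp add: bregman_dual_def X)
    then have "0 \<le> bregman_dual Z (Y T)" by (smt (verit) zero_le_power2)
    then have 1: "0 \<le> bregman_dual Z (Y T) / \<eta>" using pos by simp
    \<comment> \<open>Since \<open>Y 0 = 0\<close>, the Bregman divergence to \<open>X 0\<close> is a difference of entropies.\<close>
    have "2 * (norm (X T - X 0))\<^sup>2 \<le> S_FD (X T) - S_FD (X 0)"
      using S_FD_bregman_lower_bound[OF XF Y, of T 0] by (simp add: X[symmetric]) (simp add: Y_def)
    then have "S_FD (X 0) \<le> S_FD (X T)" by (smt (verit) zero_le_power2)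
    then have 2: "b * S_FD (X 0) \<le> b * S_FD (X T)" using b by (rule mult_left_mono)
    have 3: "K \<bullet> X 0 - K \<bullet> X T \<le> real CARD('n) * onorm ((*v) K)"
      using inner_half_minus_fermi_set_le[OF XF, of K T] by (simp add: X0 inner_diff_right)
    have "bregman_dual Z (Y 0) = S_FD Z + real CARD('n) * ln 2"
      by (simp add: bregman_dual_def X[symmetric] X0 S_FD_half) (simp add: Y_def)
    then have "bregman_dual Z (Y 0) / \<eta> \<le> real CARD('n) * ln 2 / \<eta>"
      using S_FD_nonpos[OF Z] pos by (simp add: divide_right_mono)
    with 1 2 3 show ?thesis by (simp add: P_def)
  qed
  finally show ?thesis by (simp add: c_def K_def algebra_simps)
qed

section \<open>Gaussian integrals\<close>

lemma nn_integral_lborel_translate: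
  fixes f :: "'a::euclidean_space \<Rightarrow> ennreal"
  assumes [measurable]: "f \<in> borel_measurable borel"
  shows "(\<integral>\<^sup>+x. f (a + x) \<partial>lborel) = (\<integral>\<^sup>+x. f x \<partial>lborel)"
proof -
  have "(\<integral>\<^sup>+x. f x \<partial>lborel) = (\<integral>\<^sup>+x. f x \<partial>distr lborel borel ((+) a))"
    by (simp add: lborel_distr_plus)
  then show ?thesis by (simp add: nn_integral_distr)
qed

lemma nn_integral_vec_prod:
  fixes f :: "'n::finite \<Rightarrow> real \<Rightarrow> ennreal"
  assumes [measurable]: "\<And>i. f i \<in> borel_measurable borel"
  shows "(\<integral>\<^sup>+x. (\<Prod>i\<in>UNIV. f i ((x :: real^'n) $ i)) \<partial>lborel) = (\<Prod>i\<in>UNIV. \<integral>\<^sup>+y. f i y \<partial>lborel)"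
proof -
  let ?ax = "\<lambda>i::'n. axis i (1::real)"
  have inj: "inj ?ax" by (auto simp: inj_def axis_eq_axis)
  have Basis: "(Basis :: (real^'n) set) = range ?ax" by (auto simp: Basis_vec_def)
  define g where "g b = f (inv ?ax b)" for b
  have g: "g (?ax i) = f i" for i by (simp add: g_def inv_f_f[OF inj])
  have "(\<integral>\<^sup>+x. (\<Prod>b\<in>Basis. g b ((x :: real^'n) \<bullet> b)) \<partial>lborel) = (\<Prod>b\<in>Basis. \<integral>\<^sup>+y. g b y \<partial>lborel)"
    by (intro nn_integral_lborel_prod) (auto simp: g_def)
  then show ?thesis
    by (simp add: Basis prod.reindex inj g inner_axis)
qed

lemma std_gaussian_density_eq:
  "std_gaussian_density (x :: real^'n) = (1 / sqrt (2 * pi)) ^ CARD('n) * exp (- (norm x)\<^sup>2 / 2)"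
proof -
  have "std_gaussian_density x = (\<Prod>i\<in>(UNIV::'n set). 1 / sqrt (2 * pi)) * (\<Prod>i\<in>UNIV. exp (- (x $ i)\<^sup>2 / 2))"
    by (simp add: std_gaussian_density_def std_normal_density_def prod_dividef power_divide)
  also have "(\<Prod>i\<in>UNIV. exp (- (x $ i)\<^sup>2 / 2)) = exp (- (norm x)\<^sup>2 / 2)"
    unfolding power2_norm_eq_inner
    by (simp add: inner_vec_def power2_eq_square sum_divide_distrib sum_negf flip: exp_sum)
  finally show ?thesis by simp
qed

lemma std_gaussian_density_nonneg: "0 \<le> std_gaussian_density x"
  by (simp add: std_gaussian_density_def prod_nonneg)

lemma borel_measurable_std_gaussian_density [measurable]:
  "(std_gaussian_density :: real^'n \<Rightarrow> real) \<in> borel_measurable borel"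
  unfolding std_gaussian_density_eq[abs_def] by (intro borel_measurable_continuous_onI continuous_intros) auto

lemma nn_integral_std_gaussian_density:
  "(\<integral>\<^sup>+x. ennreal (std_gaussian_density (x :: real^'n)) \<partial>lborel) = 1"
proof -
  have 1: "(\<integral>\<^sup>+y. ennreal (std_normal_density y) \<partial>lborel) = 1"
    using integral_normal_density[of 1 0] integrable_normal_density[of 1 0]
    by (subst nn_integral_eq_integral) auto
  have "(\<integral>\<^sup>+x. ennreal (std_gaussian_density (x :: real^'n)) \<partial>lborel)
      = (\<integral>\<^sup>+x. (\<Prod>i\<in>UNIV. ennreal (std_normal_density ((x :: real^'n) $ i))) \<partial>lborel)"
    by (simp add: std_gaussian_density_def prod_ennreal)
  also have "\<dots> = 1" by (subst nn_integral_vec_prod) (auto simp: 1)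
  finally show ?thesis .
qed

text \<open>
  Insert the factor \<open>1 = \<integral> h(y) dy\<close>, with \<open>h\<close> the Gaussian density, into \<open>\<integral> f(Q x) dx\<close>. Translating
  \<open>x\<close> by \<open>Q\<^sup>-\<^sup>1 y\<close>, exchanging the integrals and translating \<open>y\<close> by \<open>Q x\<close> gives
  \<open>\<integral> f(y) \<integral> h(y - Q x) dx dy\<close>. The inner integral is again \<open>1\<close>, because \<open>h\<close> depends only on the norm
  and \<open>y - Q x\<close> has the norm of \<open>x - Q\<^sup>-\<^sup>1 y\<close>. So only translation invariance and Fubini's theorem are
  used.
\<close>

lemma nn_integral_lborel_orthogonal:
  fixes Q :: "real^'n^'n" and f :: "real^'n \<Rightarrow> ennreal"
  assumes Q: "orthogonal_matrix Q" and f [measurable]: "f \<in> borel_measurable borel"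
  shows "(\<integral>\<^sup>+x. f (Q *v x) \<partial>lborel) = (\<integral>\<^sup>+x. f x \<partial>lborel)"
proof -
  define h :: "real^'n \<Rightarrow> ennreal" where "h x = ennreal (std_gaussian_density x)" for x
  have [measurable]: "h \<in> borel_measurable borel" unfolding h_def by measurable
  have h1: "(\<integral>\<^sup>+x. h x \<partial>lborel) = 1" unfolding h_def by (rule nn_integral_std_gaussian_density)
  have heq: "h x = h y" if "norm x = norm y" for x y using that by (simp add: h_def std_gaussian_density_eq)
  have [measurable]: "(\<lambda>x. R *v x) \<in> borel_measurable borel" for R :: "real^'n^'n"
    by (intro borel_measurable_continuous_onI continuous_intros)
  have QQ: "Q *v (transpose Q *v y) = y" for y
    using Q by (simp add: orthogonal_matrix_def matrix_vector_mul_assoc del: transpose_matrix_vector)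
  have nQ: "norm (Q *v x) = norm x" for x
    using isometry_norm[of Q x] Q by (simp add: orthogonal_matrix_def)
  have "(\<integral>\<^sup>+x. f (Q *v x) \<partial>lborel) = (\<integral>\<^sup>+y. h y * (\<integral>\<^sup>+x. f (Q *v x) \<partial>lborel) \<partial>lborel)"
    by (simp add: nn_integral_multc h1)
  also have "\<dots> = (\<integral>\<^sup>+y. h y * (\<integral>\<^sup>+x. f (y + Q *v x) \<partial>lborel) \<partial>lborel)"
  proof (rule nn_integral_cong)
    fix y
    have "(\<integral>\<^sup>+x. f (Q *v x) \<partial>lborel) = (\<integral>\<^sup>+x. f (y + Q *v x) \<partial>lborel)"
      using nn_integral_lborel_translate[of "\<lambda>x. f (Q *v x)" "transpose Q *v y"]
      by (simp add: matrix_vector_right_distrib QQ del: transpose_matrix_vector)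
    then show "h y * (\<integral>\<^sup>+x. f (Q *v x) \<partial>lborel) = h y * (\<integral>\<^sup>+x. f (y + Q *v x) \<partial>lborel)"
      by simp
  qed
  also have "\<dots> = (\<integral>\<^sup>+y. \<integral>\<^sup>+x. h y * f (y + Q *v x) \<partial>lborel \<partial>lborel)"
    by (simp add: nn_integral_cmult)
  also have "\<dots> = (\<integral>\<^sup>+x. \<integral>\<^sup>+y. h y * f (y + Q *v x) \<partial>lborel \<partial>lborel)"
    by (rule lborel_pair.Fubini') measurable
  also have "\<dots> = (\<integral>\<^sup>+x. \<integral>\<^sup>+y. h (y - Q *v x) * f y \<partial>lborel \<partial>lborel)"
  proof (rule nn_integral_cong)
    fix x
    show "(\<integral>\<^sup>+y. h y * f (y + Q *v x) \<partial>lborel) = (\<integral>\<^sup>+y. h (y - Q *v x) * f y \<partial>lborel)"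
      using nn_integral_lborel_translate[of "\<lambda>y. h (y - Q *v x) * f y" "Q *v x"]
      by (simp add: add.commute)
  qed
  also have "\<dots> = (\<integral>\<^sup>+y. \<integral>\<^sup>+x. h (y - Q *v x) * f y \<partial>lborel \<partial>lborel)"
    by (rule lborel_pair.Fubini'[symmetric]) measurable
  also have "\<dots> = (\<integral>\<^sup>+y. (\<integral>\<^sup>+x. h (y - Q *v x) \<partial>lborel) * f y \<partial>lborel)"
    by (simp add: nn_integral_multc)
  also have "\<dots> = (\<integral>\<^sup>+y. f y \<partial>lborel)"
  proof (rule nn_integral_cong)
    fix y
    have "h (y - Q *v x) = h (- (transpose Q *v y) + x)" for x
    proof (rule heq)
      have "y - Q *v x = - (Q *v (- (transpose Q *v y) + x))"
        by (simp add: matrix_vector_mult_diff_distrib QQ del: transpose_matrix_vector)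
      then show "norm (y - Q *v x) = norm (- (transpose Q *v y) + x)" by (metis norm_minus_cancel nQ)
    qed
    then have "(\<integral>\<^sup>+x. h (y - Q *v x) \<partial>lborel) = 1"
      using nn_integral_lborel_translate[of h "- (transpose Q *v y)"] h1 by simp
    then show "(\<integral>\<^sup>+x. h (y - Q *v x) \<partial>lborel) * f y = f y" by simp
  qed
  finally show ?thesis .
qed

text \<open>
  The left-hand side is the exponential moment of \<open>a t\<^sup>2\<close> for a standard normal \<open>t\<close>
  (\<open>nn_integral_gaussian_square_mgf\<close>). Its logarithm is \<open>a\<close> to first order, with a quadratic remainder as
  long as \<open>a\<close> stays away from \<open>1/2\<close>.
\<close>

lemma inverse_sqrt_le_exp:
  fixes a :: real
  assumes "\<bar>a\<bar> \<le> 1 / 4"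
  shows "1 / sqrt (1 - 2 * a) \<le> exp (a + 4 * a\<^sup>2)"
proof -
  have "- ln (1 - 2 * a) \<le> 2 * a + 2 * (2 * a)\<^sup>2"
  proof (cases "0 \<le> a")
    case True
    then show ?thesis using ln_one_minus_pos_lower_bound[of "2 * a"] assms by simp
  next
    case False
    then show ?thesis using ln_one_plus_pos_lower_bound[of "- 2 * a"] assms by (simp add: power2_eq_square) (smt (verit) zero_le_square)
  qed
  moreover have "1 / sqrt (1 - 2 * a) = exp (- ln (1 - 2 * a) / 2)"
    using assms by (simp add: exp_minus ln_sqrt[symmetric] inverse_eq_divide)
  ultimately show ?thesis by (simp add: power2_eq_square)
qed

lemma nn_integral_gaussian_square_mgf:
  fixes a :: real
  assumes "a < 1 / 2"
  shows "(\<integral>\<^sup>+t. ennreal (std_normal_density t * exp (a * t\<^sup>2)) \<partial>lborel) = ennreal (1 / sqrt (1 - 2 * a))"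
proof -
  define s where "s = 1 / sqrt (1 - 2 * a)"
  have s: "s > 0" "s\<^sup>2 = 1 / (1 - 2 * a)" using assms by (auto simp: s_def power_divide)
  have "std_normal_density t * exp (a * t\<^sup>2) = s * normal_density 0 s t" for t
  proof -
    have "- t\<^sup>2 / (2 * s\<^sup>2) = - t\<^sup>2 / 2 + a * t\<^sup>2" using assms unfolding s by (simp add: field_simps)
    moreover have "sqrt (2 * pi * s\<^sup>2) = sqrt (2 * pi) * s" using s(1) by (simp add: real_sqrt_mult)
    ultimately show ?thesis using s(1)
      by (simp add: std_normal_density_def normal_density_def flip: exp_add)
  qed
  then have "(\<integral>\<^sup>+t. ennreal (std_normal_density t * exp (a * t\<^sup>2)) \<partial>lborel)
      = (\<integral>\<^sup>+t. ennreal s * ennreal (normal_density 0 s t) \<partial>lborel)"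
    using s by (simp add: ennreal_mult)
  also have "\<dots> = ennreal s * (\<integral>\<^sup>+t. ennreal (normal_density 0 s t) \<partial>lborel)"
    by (rule nn_integral_cmult) measurable
  also have "(\<integral>\<^sup>+t. ennreal (normal_density 0 s t) \<partial>lborel) = 1"
    using integral_normal_density[OF s(1)] integrable_normal_density[OF s(1)]
    by (subst nn_integral_eq_integral) auto
  finally show ?thesis by (simp add: s_def)
qed

text \<open>
  In an eigenbasis of \<open>A\<close>, which by rotation invariance may be taken as the coordinate basis, the integral
  factors into one-dimensional ones. The hypothesis says that the eigenvalues lie in \<open>[-1/4, 1/4]\<close>.
\<close>

theorem gaussian_quadratic_form_mgf:
  fixes A :: "real^'n^'n"
  assumes A: "transpose A = A" and bound: "\<And>x. \<bar>x \<bullet> (A *v x)\<bar> \<le> (norm x)\<^sup>2 / 4"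
  shows "(\<integral>\<^sup>+z. ennreal (std_gaussian_density z * exp (z \<bullet> (A *v z))) \<partial>lborel)
    \<le> ennreal (exp (trace A + 4 * (norm A)\<^sup>2))"
proof -
  obtain Q d where Q: "orthogonal_matrix Q" "A = of_spectrum Q d"
    by (rule symmetric_diagonalization[OF A])
  have d: "\<bar>d $ k\<bar> \<le> 1 / 4" for k
    using bound[of "column k Q"] orthogonal_columns_inner[OF Q(1), of k k]
    by (simp add: Q(2) eigenvalue_quadratic_form[OF Q(1)] power2_norm_eq_inner)
  have nn: "0 \<le> 1 / sqrt (1 - 2 * d $ k)" for k using d[of k] by simp
  have tQ: "orthogonal_matrix (transpose Q)" using Q(1) by simp
  define f :: "real^'n \<Rightarrow> ennreal" where
    "f y = (\<Prod>k\<in>UNIV. ennreal (std_normal_density (y $ k) * exp (d $ k * (y $ k)\<^sup>2)))" for y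
  have f: "f y = ennreal (std_gaussian_density y * exp (\<Sum>k\<in>UNIV. d $ k * (y $ k)\<^sup>2))" for y
    by (simp add: f_def prod_ennreal std_gaussian_density_def prod.distrib exp_sum)
  have [measurable]: "f \<in> borel_measurable borel"
    unfolding f[abs_def] by (intro measurable_compose[OF _ measurable_ennreal] borel_measurable_times
      borel_measurable_std_gaussian_density borel_measurable_continuous_onI continuous_intros)
  have "ennreal (std_gaussian_density z * exp (z \<bullet> (A *v z))) = f (transpose Q *v z)" for z
  proof -
    have "(transpose Q *v z) $ k = column k Q \<bullet> z" for k
      by (simp add: matrix_vector_mult_def transpose_def column_def inner_vec_def del: transpose_matrix_vector)
    moreover have "norm (transpose Q *v z) = norm z"
      using isometry_norm[of "transpose Q" z] tQ by (simp add: orthogonal_matrix_def del: transpose_matrix_vector)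
    ultimately show ?thesis
      unfolding f Q(2) quadratic_form_of_spectrum std_gaussian_density_eq by simp
  qed
  then have "(\<integral>\<^sup>+z. ennreal (std_gaussian_density z * exp (z \<bullet> (A *v z))) \<partial>lborel) = (\<integral>\<^sup>+z. f z \<partial>lborel)"
    by (simp add: nn_integral_lborel_orthogonal[OF tQ] del: transpose_matrix_vector)
  also have "\<dots> = (\<Prod>k\<in>UNIV. \<integral>\<^sup>+t. ennreal (std_normal_density t * exp (d $ k * t\<^sup>2)) \<partial>lborel)"
    unfolding f_def by (rule nn_integral_vec_prod) measurable
  also have "\<dots> = (\<Prod>k\<in>UNIV. ennreal (1 / sqrt (1 - 2 * d $ k)))"
  proof (intro prod.cong refl nn_integral_gaussian_square_mgf)
    show "d $ k < 1 / 2" for k using d[of k] by linarith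
  qed
  also have "\<dots> = ennreal (\<Prod>k\<in>UNIV. 1 / sqrt (1 - 2 * d $ k))"
    by (intro prod_ennreal nn)
  also have "\<dots> \<le> ennreal (\<Prod>k\<in>UNIV. exp (d $ k + 4 * (d $ k)\<^sup>2))"
    by (intro ennreal_leI prod_mono conjI inverse_sqrt_le_exp d nn)
  also have "(\<Prod>k\<in>UNIV. exp (d $ k + 4 * (d $ k)\<^sup>2)) = exp (\<Sum>k\<in>UNIV. d $ k + 4 * (d $ k)\<^sup>2)"
    by (simp add: exp_sum)
  also have "(\<Sum>k\<in>UNIV. d $ k + 4 * (d $ k)\<^sup>2) = trace A + 4 * (norm A)\<^sup>2"
    by (simp add: Q(2) trace_of_spectrum[OF Q(1)] norm_of_spectrum_power2[OF Q(1)] sum.distrib sum_distrib_left)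
  finally show ?thesis .
qed

section \<open>Exponential moments of the sampled density and of the noise\<close>

lemma mat_fun_sqrt_fermi_set:
  assumes "X \<in> fermi_set"
  shows "transpose (mat_fun sqrt X) = mat_fun sqrt X" "mat_fun sqrt X ** mat_fun sqrt X = X"
proof -
  obtain Q d where Q: "orthogonal_matrix Q" "X = of_spectrum Q d" and d: "\<forall>k. 0 \<le> d $ k \<and> d $ k \<le> 1"
    by (rule fermi_set_diagonalization[OF assms])
  have S: "mat_fun sqrt X = of_spectrum Q (\<chi> k. sqrt (d $ k))"
    unfolding Q(2) by (rule mat_fun_diagonalization[OF Q(1)])
  show "transpose (mat_fun sqrt X) = mat_fun sqrt X" unfolding S by (rule transpose_of_spectrum)
  show "mat_fun sqrt X ** mat_fun sqrt X = X"
    unfolding S of_spectrum_mult[OF Q(1)] using d by (simp add: Q(2))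
qed

lemma norm_mat_fun_sqrt_mult:
  assumes "X \<in> fermi_set"
  shows "(norm (mat_fun sqrt X *v x))\<^sup>2 = x \<bullet> (X *v x)"
proof -
  have "(mat_fun sqrt X *v x) \<bullet> (mat_fun sqrt X *v x) = x \<bullet> ((mat_fun sqrt X ** mat_fun sqrt X) *v x)"
    by (simp add: symmetric_dot_mult[OF mat_fun_sqrt_fermi_set(1)[OF assms]] matrix_vector_mul_assoc)
  then show ?thesis by (simp add: mat_fun_sqrt_fermi_set(2)[OF assms] power2_norm_eq_inner)
qed

lemma norm_mat_fun_sqrt_mult_le:
  assumes "X \<in> fermi_set"
  shows "(norm (mat_fun sqrt X *v x))\<^sup>2 \<le> (norm x)\<^sup>2"
  using fermi_set_quadratic_form(2)[OF assms] by (simp add: norm_mat_fun_sqrt_mult[OF assms])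

lemma sampled_matrix_eq_outer:
  assumes "X \<in> fermi_set"
  shows "sampled_matrix X z = outer (mat_fun sqrt X *v z) (mat_fun sqrt X *v z)"
proof -
  have S: "mat_fun sqrt X $ i $ j = mat_fun sqrt X $ j $ i" for i j
    using mat_fun_sqrt_fermi_set(1)[OF assms] by (metis transpose_def vec_lambda_beta)
  show ?thesis
    unfolding sampled_matrix_def
    by (simp add: vec_eq_iff matrix_matrix_mult_def outer_def matrix_vector_mult_def S
        sum_distrib_left sum_distrib_right mult_ac)
qed

text \<open>
  By the duality between \<open>rho \<Psi>\<close> and compression with \<open>\<Psi>\<close>, the noise is the value at \<open>X\<close> minus the value
  at the sampled matrix of one linear functional. The sampled matrix has rank one, which gives the
  quadratic form; moving the square roots around the trace gives \<open>trace A\<close>.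
\<close>

lemma noise_eq_quadratic_form:
  fixes \<Psi> :: "real^'n^'m" and X Z :: "real^'n^'n" and V :: "real^'m^'m"
  assumes X: "X \<in> fermi_set"
  defines "A \<equiv> mat_fun sqrt X ** (transpose \<Psi> ** diag_mat (V *v (rho \<Psi> X - rho \<Psi> Z)) ** \<Psi>) ** mat_fun sqrt X"
  assumes V: "transpose V = V"
  shows "noise \<Psi> V Z X z = trace A - z \<bullet> (A *v z)"
proof -
  define v where "v = V *v (rho \<Psi> X - rho \<Psi> Z)"
  define G where "G = transpose \<Psi> ** diag_mat v ** \<Psi>"
  define S where "S = mat_fun sqrt X"
  have S: "transpose S = S" "S ** S = X" using mat_fun_sqrt_fermi_set[OF X] by (simp_all add: S_def)
  have A: "A = S ** G ** S" by (simp add: A_def S_def G_def v_def)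
  have tG: "transpose G = G" unfolding G_def by (rule transpose_congruence_diag)
  have "noise \<Psi> V Z X z = (V *v rho \<Psi> X - V *v rho \<Psi> (sampled_matrix X z)) \<bullet> (rho \<Psi> X - rho \<Psi> Z)"
    by (simp add: noise_def inner_diff_left inner_grad_E_tilde rho_diff)
  also have "\<dots> = (V *v (rho \<Psi> X - rho \<Psi> (sampled_matrix X z))) \<bullet> (rho \<Psi> X - rho \<Psi> Z)"
    by (simp add: matrix_vector_mult_diff_distrib)
  also have "\<dots> = (rho \<Psi> X - rho \<Psi> (sampled_matrix X z)) \<bullet> v"
    unfolding v_def by (rule symmetric_dot_mult[OF V])
  also have "\<dots> = v \<bullet> rho \<Psi> X - v \<bullet> rho \<Psi> (sampled_matrix X z)"
    by (simp add: inner_diff_right inner_commute)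
  also have "v \<bullet> rho \<Psi> X = trace A"
  proof -
    have "trace A = trace (G ** (S ** S))" unfolding A by (metis matrix_mul_assoc trace_mul_sym)
    then show ?thesis by (simp add: S rho_inner G_def[symmetric] trace_mult_symmetric[OF tG])
  qed
  also have "v \<bullet> rho \<Psi> (sampled_matrix X z) = (S *v z) \<bullet> (G *v (S *v z))"
    by (simp add: rho_inner G_def[symmetric] sampled_matrix_eq_outer[OF X] S_def[symmetric] quadratic_form_eq_inner_outer)
  also have "\<dots> = z \<bullet> (A *v z)"
    by (simp add: A symmetric_dot_mult[OF S(1)] flip: matrix_vector_mul_assoc)
  finally show ?thesis .
qed

text \<open>
  The trace terms cancel, as the noise is centred. What is left is the squared Frobenius norm of the
  matrix \<open>B\<close>, whose eigenvalues are at most \<open>l (norm_inf V * c_Psi \<Psi>)\<close> in absolute value.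
\<close>

lemma noise_mgf:
  fixes \<Psi> :: "real^'n^'m" and X Z :: "real^'n^'n" and V :: "real^'m^'m"
  assumes Psi: "transpose \<Psi> ** \<Psi> = mat 1" and V: "transpose V = V"
    and X: "X \<in> fermi_set" and Z: "Z \<in> fermi_set"
    and l: "0 \<le> l" "l * (norm_inf V * c_Psi \<Psi>) \<le> 1 / 4"
  shows "(\<integral>\<^sup>+z. ennreal (std_gaussian_density z * exp (l * noise \<Psi> V Z X z)) \<partial>lborel)
    \<le> ennreal (exp (4 * real CARD('n) * (l * (norm_inf V * c_Psi \<Psi>))\<^sup>2))"
proof -
  define b where "b = norm_inf V * c_Psi \<Psi>"
  define v where "v = V *v (rho \<Psi> X - rho \<Psi> Z)"
  define G where "G = transpose \<Psi> ** diag_mat v ** \<Psi>"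
  define S where "S = mat_fun sqrt X"
  have S: "transpose S = S" using mat_fun_sqrt_fermi_set[OF X] by (simp_all add: S_def)
  define A where "A = S ** G ** S"
  define B where "B = (- l) *\<^sub>R A"
  have v: "\<bar>v $ p\<bar> \<le> b" for p
    unfolding v_def b_def
  proof (rule abs_mult_vec_le_norm_inf)
    show "\<bar>(rho \<Psi> X - rho \<Psi> Z) $ q\<bar> \<le> c_Psi \<Psi>" for q
      using rho_fermi_set[OF X, of \<Psi> q] rho_fermi_set[OF Z, of \<Psi> q] by simp
  qed
  have "0 \<le> b" using v abs_ge_zero order_trans by blast
  have tG: "transpose G = G" unfolding G_def by (rule transpose_congruence_diag)
  have tB: "transpose B = B"
    unfolding B_def A_def by (simp only: transpose_diff_scaleR matrix_transpose_mul S tG matrix_mul_assoc)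
  have Bx: "x \<bullet> (B *v x) = - l * (x \<bullet> (A *v x))" for x
    unfolding B_def by (simp only: inner_scaleR_right flip: scaleR_matrix_vector_assoc)
  have boundB: "\<bar>x \<bullet> (B *v x)\<bar> \<le> (l * b) * (norm x)\<^sup>2" for x
  proof -
    have "x \<bullet> (A *v x) = (S *v x) \<bullet> (G *v (S *v x))"
      by (simp add: A_def symmetric_dot_mult[OF S] flip: matrix_vector_mul_assoc)
    then have "\<bar>x \<bullet> (A *v x)\<bar> \<le> b * (norm (S *v x))\<^sup>2"
      using quadratic_form_congruence_bound[OF Psi v, of "S *v x"] by (simp add: G_def)
    also have "\<dots> \<le> b * (norm x)\<^sup>2"
      unfolding S_def by (intro mult_left_mono norm_mat_fun_sqrt_mult_le X \<open>0 \<le> b\<close>)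
    finally have "l * \<bar>x \<bullet> (A *v x)\<bar> \<le> l * (b * (norm x)\<^sup>2)" using l(1) by (rule mult_left_mono)
    then show ?thesis using l(1)
      by (simp add: Bx abs_mult mult.assoc)
  qed
  have bound4: "\<bar>x \<bullet> (B *v x)\<bar> \<le> (norm x)\<^sup>2 / 4" for x
  proof -
    have "(l * b) * (norm x)\<^sup>2 \<le> 1 / 4 * (norm x)\<^sup>2" using l(2) by (intro mult_right_mono) (auto simp: b_def)
    then show ?thesis using boundB[of x] by simp
  qed
  have eq: "l * noise \<Psi> V Z X z = z \<bullet> (B *v z) - trace B" for z
  proof -
    have "trace B = - l * trace A" by (simp add: B_def trace_eq_inner)
    moreover have "noise \<Psi> V Z X z = trace A - z \<bullet> (A *v z)"
      using noise_eq_quadratic_form[OF X V] by (simp add: A_def S_def G_def v_def)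
    ultimately show ?thesis by (simp add: Bx right_diff_distrib)
  qed
  have "(\<integral>\<^sup>+z. ennreal (std_gaussian_density z * exp (l * noise \<Psi> V Z X z)) \<partial>lborel)
     = (\<integral>\<^sup>+z. ennreal (exp (- trace B)) * ennreal (std_gaussian_density z * exp (z \<bullet> (B *v z))) \<partial>lborel)"
    unfolding eq by (intro nn_integral_cong)
      (simp add: exp_diff exp_minus field_simps std_gaussian_density_nonneg flip: ennreal_mult)
  also have "\<dots> = ennreal (exp (- trace B)) * (\<integral>\<^sup>+z. ennreal (std_gaussian_density z * exp (z \<bullet> (B *v z))) \<partial>lborel)"
    by (intro nn_integral_cmult measurable_compose[OF _ measurable_ennreal] borel_measurable_times)
       (auto intro!: borel_measurable_continuous_onI continuous_intros)
  also have "\<dots> \<le> ennreal (exp (- trace B)) * ennreal (exp (trace B + 4 * (norm B)\<^sup>2))"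
    by (intro mult_left_mono gaussian_quadratic_form_mgf tB bound4) auto
  also have "\<dots> = ennreal (exp (4 * (norm B)\<^sup>2))"
    by (simp flip: ennreal_mult exp_add)
  also have "\<dots> \<le> ennreal (exp (4 * real CARD('n) * (l * b)\<^sup>2))"
    using norm_le_of_quadratic_form_bound[OF tB boundB] by (intro ennreal_leI) simp
  finally show ?thesis by (simp add: b_def)
qed

lemma rho_sampled_matrix:
  fixes X :: "real^'n^'n"
  assumes "X \<in> fermi_set"
  shows "rho \<Psi> (sampled_matrix X z) $ p = ((mat_fun sqrt X *v \<Psi> $ p) \<bullet> z)\<^sup>2"
proof -
  let ?S = "mat_fun sqrt X"
  have "outer x x *v y = (x \<bullet> y) *\<^sub>R x" for x y :: "real^'n"
    by (simp add: vec_eq_iff outer_def matrix_vector_mult_def inner_vec_def sum_distrib_left mult_ac)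
  moreover have "\<Psi> $ p \<bullet> (?S *v z) = (?S *v \<Psi> $ p) \<bullet> z"
    using symmetric_dot_mult[OF mat_fun_sqrt_fermi_set(1)[OF assms]] by simp
  moreover from this have "(?S *v z) \<bullet> \<Psi> $ p = (?S *v \<Psi> $ p) \<bullet> z"
    by (simp add: inner_commute)
  ultimately show ?thesis
    by (simp add: rho_nth_quadratic_form sampled_matrix_eq_outer[OF assms] power2_eq_square)
qed

text \<open>
  An instance with a matrix of rank one: \<open>A\<close> is \<open>u u\<^sup>T / (4 c_Psi \<Psi>)\<close> with
  \<open>\<parallel>u\<parallel>\<^sup>2 \<le> c_Psi \<Psi>\<close>, so its only nonzero eigenvalue \<open>r\<close> is at most \<open>1/4\<close>.
\<close>

lemma rho_sampled_matrix_mgf: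
  fixes \<Psi> :: "real^'n^'m" and X :: "real^'n^'n"
  assumes X: "X \<in> fermi_set" and pos: "0 < c_Psi \<Psi>"
  shows "(\<integral>\<^sup>+z. ennreal (std_gaussian_density z * exp (rho \<Psi> (sampled_matrix X z) $ p / (4 * c_Psi \<Psi>))) \<partial>lborel)
    \<le> ennreal (exp (1 / 2))"
proof -
  define u where "u = mat_fun sqrt X *v \<Psi> $ p"
  have u: "(norm u)\<^sup>2 \<le> c_Psi \<Psi>"
    unfolding u_def using norm_mat_fun_sqrt_mult_le[OF X] row_norm_le_c_Psi order_trans by blast
  define r where "r = (norm u)\<^sup>2 / (4 * c_Psi \<Psi>)"
  have r: "0 \<le> r" "r \<le> 1 / 4" using u pos by (auto simp: r_def field_simps)
  define A where "A = (1 / (4 * c_Psi \<Psi>)) *\<^sub>R outer u u"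
  have tA: "transpose A = A" by (simp add: A_def transpose_def outer_def vec_eq_iff mult_ac)
  have quad: "x \<bullet> (A *v x) = (u \<bullet> x)\<^sup>2 / (4 * c_Psi \<Psi>)" for x
    unfolding quadratic_form_eq_inner_outer A_def
    by (simp add: inner_vec_def outer_def power2_eq_square sum_product sum_divide_distrib mult_ac)
  have bound: "\<bar>x \<bullet> (A *v x)\<bar> \<le> (norm x)\<^sup>2 / 4" for x
  proof -
    have "(u \<bullet> x)\<^sup>2 \<le> (norm u)\<^sup>2 * (norm x)\<^sup>2" by (simp add: Cauchy_Schwarz_ineq power2_norm_eq_inner)
    also have "\<dots> \<le> c_Psi \<Psi> * (norm x)\<^sup>2" by (intro mult_right_mono u) auto
    finally show ?thesis using pos by (simp add: quad field_simps)
  qed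
  have "outer u u \<bullet> outer u u = (u \<bullet> u)\<^sup>2"
    by (simp add: inner_vec_def outer_def power2_eq_square sum_product mult_ac)
  then have "(norm (outer u u))\<^sup>2 = ((norm u)\<^sup>2)\<^sup>2" by (simp only: power2_norm_eq_inner)
  then have oo: "norm (outer u u) = (norm u)\<^sup>2" by (rule power2_eq_imp_eq) auto
  have "trace A = r"
    by (simp add: A_def r_def trace_def outer_def power2_norm_eq_inner inner_vec_def sum_divide_distrib)
  moreover have "(norm A)\<^sup>2 = r\<^sup>2"
    using pos by (simp add: A_def r_def oo)
  ultimately have "trace A + 4 * (norm A)\<^sup>2 \<le> 1 / 4 + 4 * (1 / 4)\<^sup>2"
    using r power_mono[of r "1 / 4" 2] by (intro add_mono mult_left_mono) auto
  then have le: "trace A + 4 * (norm A)\<^sup>2 \<le> 1 / 2" by (simp add: power2_eq_square)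
  have "(\<integral>\<^sup>+z. ennreal (std_gaussian_density z * exp (rho \<Psi> (sampled_matrix X z) $ p / (4 * c_Psi \<Psi>))) \<partial>lborel)
    = (\<integral>\<^sup>+z. ennreal (std_gaussian_density z * exp (z \<bullet> (A *v z))) \<partial>lborel)"
    by (simp add: quad rho_sampled_matrix[OF X] u_def)
  also have "\<dots> \<le> ennreal (exp (trace A + 4 * (norm A)\<^sup>2))"
    by (rule gaussian_quadratic_form_mgf[OF tA bound])
  also have "\<dots> \<le> ennreal (exp (1 / 2))" using le by (intro ennreal_leI) simp
  finally show ?thesis .
qed

section \<open>Continuity of the functional calculus and measurability of the iterates\<close>

lemma continuous_on_transpose [continuous_intros]:
  fixes f :: "'a::topological_space \<Rightarrow> real^'n^'m"
  shows "continuous_on S f \<Longrightarrow> continuous_on S (\<lambda>x. transpose (f x))"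
  unfolding transpose_def by (intro continuous_intros)

lemma continuous_on_matrix_matrix_mult [continuous_intros]:
  fixes f :: "'a::topological_space \<Rightarrow> real^'n^'m" and g :: "'a \<Rightarrow> real^'k^'n"
  shows "continuous_on S f \<Longrightarrow> continuous_on S g \<Longrightarrow> continuous_on S (\<lambda>x. f x ** g x)"
  unfolding matrix_matrix_mult_def by (intro continuous_intros)

lemma continuous_on_matrix_vector_mult [continuous_intros]:
  fixes f :: "'a::topological_space \<Rightarrow> real^'n^'m" and g :: "'a \<Rightarrow> real^'n"
  shows "continuous_on S f \<Longrightarrow> continuous_on S g \<Longrightarrow> continuous_on S (\<lambda>x. f x *v g x)"
  unfolding matrix_vector_mult_def by (intro continuous_intros)

lemma continuous_on_diag_mat [continuous_intros]:
  fixes f :: "'a::topological_space \<Rightarrow> real^'n"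
  shows "continuous_on S f \<Longrightarrow> continuous_on S (\<lambda>x. diag_mat (f x))"
proof -
  assume f: "continuous_on S f"
  have "continuous_on S (\<lambda>x. if i = j then f x $ i else 0)" for i j
    by (cases "i = j") (auto intro!: continuous_intros f)
  then show ?thesis unfolding diag_mat_def by (intro continuous_on_vec_lambda)
qed

lemma continuous_on_outer [continuous_intros]:
  fixes f g :: "'a::topological_space \<Rightarrow> real^'n"
  shows "continuous_on S f \<Longrightarrow> continuous_on S g \<Longrightarrow> continuous_on S (\<lambda>x. outer (f x) (g x))"
  unfolding outer_def by (intro continuous_intros)

lemma compact_orthogonal_matrices: "compact {Q :: real^'n^'n. orthogonal_matrix Q}"
proof -
  have "norm Q = sqrt (real CARD('n))" if "orthogonal_matrix Q" for Q :: "real^'n^'n"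
  proof -
    have "Q \<bullet> Q = (\<Sum>j\<in>UNIV. column j Q \<bullet> column j Q)"
      unfolding inner_vec_def column_def by (subst sum.swap) simp
    then show ?thesis by (simp add: norm_eq_sqrt_inner orthogonal_columns_inner[OF that])
  qed
  then have "bounded {Q :: real^'n^'n. orthogonal_matrix Q}"
    unfolding bounded_iff by (metis mem_Collect_eq order_refl)
  moreover have "closed {Q :: real^'n^'n. orthogonal_matrix Q}"
    unfolding orthogonal_matrix by (intro closed_Collect_eq continuous_intros)
  ultimately show ?thesis by (simp add: compact_eq_bounded_closed)
qed

text \<open>
  Over the symmetric matrices of norm at most \<open>r\<close>, the graph of \<open>mat_fun f\<close> is the image of a compact set,
  of pairs of an orthogonal matrix and a vector of eigenvalues, under a continuous map. A function with
  compact graph is continuous.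
\<close>

lemma continuous_on_mat_fun_symmetric:
  fixes f :: "real \<Rightarrow> real"
  assumes f: "continuous_on UNIV f"
  shows "continuous_on {A :: real^'n^'n. transpose A = A} (mat_fun f)"
proof -
  let ?S = "{A :: real^'n^'n. transpose A = A}"
  have bounded: "continuous_on (?S \<inter> cball 0 r) (mat_fun f)" for r
  proof -
    define K where "K = {Q :: real^'n^'n. orthogonal_matrix Q} \<times> cball (0 :: real^'n) r"
    define F where "F = (\<lambda>(Q :: real^'n^'n, d :: real^'n). (of_spectrum Q d, of_spectrum Q (\<chi> i. f (d $ i))))"
    have "continuous_on K F"
      unfolding F_def case_prod_unfold
      by (intro continuous_intros continuous_on_compose2[OF f]) auto
    moreover have "compact K" unfolding K_def by (intro compact_Times compact_orthogonal_matrices) simp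
    ultimately have cF: "compact (F ` K)" by (rule compact_continuous_image)
    have nrm: "norm (of_spectrum Q d) = norm d" if "orthogonal_matrix Q" for Q :: "real^'n^'n" and d
    proof -
      have "(norm (of_spectrum Q d))\<^sup>2 = (norm d)\<^sup>2"
        unfolding norm_of_spectrum_power2[OF that] power2_norm_eq_inner[of d]
        by (simp add: inner_vec_def power2_eq_square)
      then show ?thesis by (rule power2_eq_imp_eq) auto
    qed
    have graph: "(\<lambda>A. (A, mat_fun f A)) ` (?S \<inter> cball 0 r) = F ` K"
    proof (intro equalityI subsetI)
      fix y assume "y \<in> (\<lambda>A. (A, mat_fun f A)) ` (?S \<inter> cball 0 r)"
      then obtain A where A: "transpose A = A" "norm A \<le> r" "y = (A, mat_fun f A)" by auto
      obtain Q d where Q: "orthogonal_matrix Q" "A = of_spectrum Q d"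
        by (rule symmetric_diagonalization[OF A(1)])
      then have "y = F (Q, d)" by (simp add: F_def A(3) mat_fun_diagonalization)
      moreover have "(Q, d) \<in> K" using Q A(2) by (simp add: K_def nrm)
      ultimately show "y \<in> F ` K" by blast
    next
      fix y assume "y \<in> F ` K"
      then obtain Q d where Q: "orthogonal_matrix Q" "norm d \<le> r" "y = F (Q, d)" by (auto simp: K_def)
      then have "y = (of_spectrum Q d, mat_fun f (of_spectrum Q d))"
        by (simp add: F_def mat_fun_diagonalization)
      moreover have "of_spectrum Q d \<in> ?S \<inter> cball 0 r"
        using Q(2) by (simp add: nrm[OF Q(1)]) (rule transpose_of_spectrum)
      ultimately show "y \<in> (\<lambda>A. (A, mat_fun f A)) ` (?S \<inter> cball 0 r)" by blast
    qed
    show ?thesis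
    proof (rule continuous_from_closed_graph)
      show "compact (snd ` F ` K)" by (intro compact_continuous_image cF continuous_intros)
      show "mat_fun f \<in> ?S \<inter> cball 0 r \<rightarrow> snd ` F ` K"
        unfolding graph[symmetric] by force
      show "closed ((\<lambda>x. (x, mat_fun f x)) ` (?S \<inter> cball 0 r))"
        unfolding graph by (rule compact_imp_closed[OF cF])
    qed
  qed
  show ?thesis
    unfolding continuous_on_eq_continuous_within
  proof
    fix A assume A: "A \<in> ?S"
    define r where "r = norm A + 1"
    have "continuous (at A within ?S \<inter> cball 0 r) (mat_fun f)"
      using bounded[of r] A by (simp add: continuous_on_eq_continuous_within r_def)
    moreover have "at A within ?S \<inter> cball 0 r = at A within ?S"
      by (rule at_within_nhd[of _ "ball 0 r"]) (auto simp: r_def)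
    ultimately show "continuous (at A within ?S) (mat_fun f)" by simp
  qed
qed

lemma continuous_on_mat_fun:
  fixes g :: "'a::topological_space \<Rightarrow> real^'n^'n"
  assumes "continuous_on UNIV f" "continuous_on S g" "\<And>x. x \<in> S \<Longrightarrow> transpose (g x) = g x"
  shows "continuous_on S (\<lambda>x. mat_fun f (g x))"
  using assms by (intro continuous_on_compose2[OF continuous_on_mat_fun_symmetric[OF assms(1)]]) auto

lemma transpose_mat_fun:
  fixes A :: "real^'n^'n"
  assumes "transpose A = A"
  shows "transpose (mat_fun f A) = mat_fun f A"
proof -
  obtain Q d where Q: "orthogonal_matrix Q" "A = of_spectrum Q d"
    by (rule symmetric_diagonalization[OF assms])
  then show ?thesis by (simp add: mat_fun_diagonalization transpose_of_spectrum del: transpose_matrix_vector)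
qed

lemma continuous_logistic: "continuous_on UNIV logistic"
proof -
  have "1 + exp (- x) \<noteq> 0" for x :: real by (smt (verit) exp_gt_zero)
  then show ?thesis unfolding logistic_def by (intro continuous_intros) auto
qed

lemma continuous_on_logistic_mat_fun [continuous_intros]:
  assumes "continuous_on S g" "\<And>x. x \<in> S \<Longrightarrow> transpose (g x) = g x"
  shows "continuous_on S (\<lambda>x. mat_fun logistic (g x))"
  using continuous_on_mat_fun[OF continuous_logistic] assms by blast

lemma continuous_on_sampled_matrix:
  fixes g :: "'a::topological_space \<Rightarrow> real^'n^'n"
  assumes "continuous_on S g" "\<And>x. x \<in> S \<Longrightarrow> transpose (g x) = g x" "continuous_on S h"
  shows "continuous_on S (\<lambda>x. sampled_matrix (mat_fun logistic (g x)) (h x))"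
  unfolding sampled_matrix_def
  by (intro continuous_intros continuous_on_mat_fun assms transpose_mat_fun)
     (auto intro!: continuous_intros)

lemma continuous_on_rho [continuous_intros]:
  fixes g :: "'a::topological_space \<Rightarrow> real^'n^'n"
  shows "continuous_on S g \<Longrightarrow> continuous_on S (\<lambda>x. rho \<Psi> (g x))"
  unfolding rho_def by (intro continuous_intros)

lemma continuous_on_grad_E_tilde [continuous_intros]:
  fixes g :: "'a::topological_space \<Rightarrow> real^'n^'n"
  shows "continuous_on S g \<Longrightarrow> continuous_on S (\<lambda>x. grad_E_tilde \<Psi> V (g x))"
  unfolding grad_E_tilde_def by (intro continuous_intros)

lemma continuous_on_noise:
  fixes g :: "'a::topological_space \<Rightarrow> real^'n^'n"
  assumes "continuous_on S g" "\<And>x. x \<in> S \<Longrightarrow> transpose (g x) = g x" "continuous_on S h"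
  shows "continuous_on S (\<lambda>x. noise \<Psi> V Z (mat_fun logistic (g x)) (h x))"
  unfolding noise_def by (intro continuous_intros continuous_on_sampled_matrix assms)

text \<open>
  In this form the entropy involves \<open>fermi_entropy\<close> only at interior points of the unit interval, where
  continuity is immediate.
\<close>

lemma S_FD_logistic:
  fixes Y :: "real^'n^'n"
  assumes "transpose Y = Y"
  shows "S_FD (mat_fun logistic Y) = trace (mat_fun (\<lambda>x. fermi_entropy (logistic x)) Y)"
proof -
  obtain Q d where Q: "orthogonal_matrix Q" "Y = of_spectrum Q d"
    by (rule symmetric_diagonalization[OF assms])
  then show ?thesis by (simp add: mat_fun_diagonalization S_FD_of_spectrum trace_of_spectrum)
qed

lemma continuous_fermi_entropy_logistic: "continuous_on UNIV (\<lambda>x. fermi_entropy (logistic x))"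
proof -
  have "logistic x \<noteq> 0" "1 - logistic x \<noteq> 0" for x using logistic_bounds[of x] by auto
  then show ?thesis unfolding fermi_entropy_def
    by (intro continuous_intros continuous_on_subset[OF continuous_logistic]) auto
qed

lemma continuous_on_free_energy_logistic:
  fixes \<Psi> :: "real^'n^'m"
  shows "continuous_on {Y. transpose Y = Y} (\<lambda>Y. free_energy \<Psi> V C \<beta> (mat_fun logistic Y) - \<mu> * trace (mat_fun logistic Y))"
proof -
  have "continuous_on {Y :: real^'n^'n. transpose Y = Y} (\<lambda>Y. trace (mat_fun (\<lambda>x. fermi_entropy (logistic x)) Y))"
    unfolding trace_eq_inner
    by (intro continuous_intros continuous_on_mat_fun_symmetric continuous_fermi_entropy_logistic)
  then have "continuous_on {Y :: real^'n^'n. transpose Y = Y} (\<lambda>Y. S_FD (mat_fun logistic Y))"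
    by (rule continuous_on_eq) (simp add: S_FD_logistic)
  then show ?thesis
    unfolding free_energy_def energy_def E_tilde_def trace_eq_inner
    by (intro continuous_intros) auto
qed

lemma borel_measurable_continuous_on_compose:
  assumes "continuous_on S h" "f \<in> borel_measurable M" "\<And>x. x \<in> space M \<Longrightarrow> f x \<in> S"
  shows "(\<lambda>x. h (f x)) \<in> borel_measurable M"
proof -
  have "f \<in> measurable M (restrict_space borel S)"
    using assms by (intro measurable_restrict_space2) auto
  then show ?thesis
    using borel_measurable_continuous_on_restrict[OF assms(1)] by (rule measurable_compose)
qed

lemma borel_measurable_dual_iterate:
  fixes z :: "nat \<Rightarrow> 'w \<Rightarrow> real^'n" and \<Psi> :: "real^'n^'m"
  assumes C: "transpose C = C"
  shows "(\<And>i. i < t \<Longrightarrow> z i \<in> borel_measurable M) \<Longrightarrow>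
    (\<lambda>\<omega>. dual_iterate \<Psi> V C \<mu> b \<eta> (\<lambda>i. z i \<omega>) t) \<in> borel_measurable M"
proof (induction t)
  case (Suc t)
  let ?S = "{Y :: real^'n^'n. transpose Y = Y} \<times> (UNIV :: (real^'n) set)"
  have "continuous_on ?S (\<lambda>p. dual_step b \<eta> (fst p) (stoch_grad \<Psi> V C (mat_fun logistic (fst p)) (snd p) - \<mu> *\<^sub>R mat 1))"
    unfolding dual_step_def stoch_grad_def
    by (intro continuous_intros continuous_on_sampled_matrix) auto
  from borel_measurable_continuous_on_compose[OF this, of "\<lambda>\<omega>. (dual_iterate \<Psi> V C \<mu> b \<eta> (\<lambda>i. z i \<omega>) t, z t \<omega>)"]
  show ?case using Suc by (simp add: Let_def transpose_dual_iterate[OF C])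
qed simp

lemma dual_iterate_cong:
  "(\<And>i. i < t \<Longrightarrow> z i = z' i) \<Longrightarrow> dual_iterate \<Psi> V C \<mu> b \<eta> z t = dual_iterate \<Psi> V C \<mu> b \<eta> z' t"
  by (induction t) (simp_all add: Let_def)

lemma borel_measurable_dual_iterate_compose:
  fixes z :: "nat \<Rightarrow> 'w \<Rightarrow> real^'n" and \<Psi> :: "real^'n^'m"
  assumes C: "transpose C = C" and z: "\<And>i. i < t \<Longrightarrow> z i \<in> borel_measurable M" and x: "x \<in> borel_measurable M"
    and h: "continuous_on ({Y :: real^'n^'n. transpose Y = Y} \<times> (UNIV :: (real^'n) set)) (\<lambda>p. h (fst p) (snd p))"
  shows "(\<lambda>\<omega>. h (dual_iterate \<Psi> V C \<mu> b \<eta> (\<lambda>i. z i \<omega>) t) (x \<omega>)) \<in> borel_measurable M"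
  using borel_measurable_continuous_on_compose[OF h, of "\<lambda>\<omega>. (dual_iterate \<Psi> V C \<mu> b \<eta> (\<lambda>i. z i \<omega>) t, x \<omega>)" M]
    borel_measurable_dual_iterate[OF C z, where \<Psi> = \<Psi> and V = V and \<mu> = \<mu> and b = b and \<eta> = \<eta> and t = t] x
  by (simp add: transpose_dual_iterate[OF C])

lemma continuous_on_noise_pair:
  "continuous_on ({Y :: real^'n^'n. transpose Y = Y} \<times> (UNIV :: (real^'n) set))
    (\<lambda>p. noise \<Psi> V Z (mat_fun logistic (fst p)) (snd p))"
  by (intro continuous_on_noise continuous_intros) auto

lemma continuous_on_rho_pair:
  "continuous_on ({Y :: real^'n^'n. transpose Y = Y} \<times> (UNIV :: (real^'n) set))
    (\<lambda>p. rho \<Psi> (sampled_matrix (mat_fun logistic (fst p)) (snd p)) $ q)"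
  by (intro continuous_on_sampled_matrix continuous_intros) auto

lemma borel_measurable_noise_iterate:
  fixes z :: "nat \<Rightarrow> 'w \<Rightarrow> real^'n" and \<Psi> :: "real^'n^'m"
  assumes "transpose C = C" "\<And>i. i < t \<Longrightarrow> z i \<in> borel_measurable M" "x \<in> borel_measurable M"
  shows "(\<lambda>\<omega>. noise \<Psi> V Z (mat_fun logistic (dual_iterate \<Psi> V C \<mu> b \<eta> (\<lambda>i. z i \<omega>) t)) (x \<omega>))
    \<in> borel_measurable M"
  by (rule borel_measurable_dual_iterate_compose[OF assms continuous_on_noise_pair])

lemma borel_measurable_rho_iterate:
  fixes z :: "nat \<Rightarrow> 'w \<Rightarrow> real^'n" and \<Psi> :: "real^'n^'m"
  assumes "transpose C = C" "\<And>i. i < t \<Longrightarrow> z i \<in> borel_measurable M" "x \<in> borel_measurable M"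
  shows "(\<lambda>\<omega>. rho \<Psi> (sampled_matrix (mat_fun logistic (dual_iterate \<Psi> V C \<mu> b \<eta> (\<lambda>i. z i \<omega>) t)) (x \<omega>)) $ p)
    \<in> borel_measurable M"
  by (rule borel_measurable_dual_iterate_compose[OF assms continuous_on_rho_pair])

section \<open>Independence and exponential moments along the iteration\<close>

context prob_space
begin

text \<open>
  Freezing: the sample at time \<open>t\<close> is independent of the earlier ones, so the integral over it can be
  carried out first, with the past held fixed.
\<close>

lemma nn_integral_independent_future:
  fixes z :: "nat \<Rightarrow> 'a \<Rightarrow> 'b::euclidean_space" and g :: "'b \<Rightarrow> ennreal"
  assumes ind: "indep_vars (\<lambda>_. borel) z {..<T}" and t: "t < T"
    and dist: "distributed M lborel (z t) g"
    and G: "G \<in> borel_measurable (PiM {..<t} (\<lambda>_. borel) \<Otimes>\<^sub>M borel)"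
  shows "(\<integral>\<^sup>+\<omega>. G (\<lambda>i\<in>{..<t}. z i \<omega>, z t \<omega>) \<partial>M)
    = (\<integral>\<^sup>+\<omega>. (\<integral>\<^sup>+x. g x * G (\<lambda>i\<in>{..<t}. z i \<omega>, x) \<partial>lborel) \<partial>M)"
proof -
  let ?P = "PiM {..<t} (\<lambda>_. borel :: 'b measure)"
  let ?past = "\<lambda>\<omega>. \<lambda>i\<in>{..<t}. z i \<omega>"
  have g [measurable]: "g \<in> borel_measurable borel" using distributed_borel_measurable[OF dist] by simp
  let ?P' = "PiM {t} (\<lambda>_. borel :: 'b measure)"
  \<comment> \<open>The new sample is kept as a function on \<open>{t}\<close>, because \<open>indep_var\<close> relates variables of one type.\<close>
  let ?now = "\<lambda>\<omega>. \<lambda>i\<in>{t}. z i \<omega>"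
  have iv: "indep_var ?P ?past ?P' ?now"
    by (rule indep_var_restrict[OF ind]) (use t in auto)
  have past [measurable]: "?past \<in> measurable M ?P" and now [measurable]: "?now \<in> measurable M ?P'"
    using iv by (auto dest: indep_var_rv1 indep_var_rv2)
  have zt [measurable]: "z t \<in> borel_measurable M" using distributed_measurable[OF dist] by simp
  have joint: "distr M ?P ?past \<Otimes>\<^sub>M distr M ?P' ?now = distr M (?P \<Otimes>\<^sub>M ?P') (\<lambda>\<omega>. (?past \<omega>, ?now \<omega>))"
    using iv by (simp add: indep_var_distribution_eq)
  have G' [measurable]: "(\<lambda>p. G (fst p, snd p t)) \<in> borel_measurable (?P \<Otimes>\<^sub>M ?P')"
    by (rule measurable_compose[OF _ G]) measurable
  have "distr M borel (z t) = distr M lborel (z t)" by (rule distr_cong) auto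
  then have dz: "distr M borel (z t) = density lborel g"
    using distributed_distr_eq_density[OF dist] by simp
  interpret Z: prob_space "distr M ?P' ?now" by (rule prob_space_distr) measurable
  have "(\<integral>\<^sup>+\<omega>. G (?past \<omega>, z t \<omega>) \<partial>M) = (\<integral>\<^sup>+p. G (fst p, snd p t) \<partial>(distr M ?P ?past \<Otimes>\<^sub>M distr M ?P' ?now))"
    unfolding joint using G' by (subst nn_integral_distr) (auto intro!: measurable_Pair past now)
  also have "\<dots> = (\<integral>\<^sup>+f. \<integral>\<^sup>+h. G (f, h t) \<partial>distr M ?P' ?now \<partial>distr M ?P ?past)"
    using G' by (subst Z.nn_integral_fst[symmetric]) (simp_all cong: measurable_cong_sets)
  also have "\<dots> = (\<integral>\<^sup>+\<omega>. \<integral>\<^sup>+h. G (?past \<omega>, h t) \<partial>distr M ?P' ?now \<partial>M)"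
  proof (rule nn_integral_distr[OF past])
    show "(\<lambda>f. \<integral>\<^sup>+h. G (f, h t) \<partial>distr M ?P' ?now) \<in> borel_measurable (distr M ?P ?past)"
      using Z.borel_measurable_nn_integral_fst[of "\<lambda>p. G (fst p, snd p t)" ?P] G'
      by (simp cong: measurable_cong_sets)
  qed
  also have "\<dots> = (\<integral>\<^sup>+\<omega>. (\<integral>\<^sup>+x. g x * G (?past \<omega>, x) \<partial>lborel) \<partial>M)"
  proof (rule nn_integral_cong)
    fix \<omega> assume "\<omega> \<in> space M"
    then have "?past \<omega> \<in> space ?P" using past by (rule measurable_space[rotated])
    then have "(\<lambda>x. G (?past \<omega>, x)) \<in> borel_measurable borel"
      using G by (rule measurable_compose_Pair1)
    then have G1 [measurable]: "(\<lambda>x. G (?past \<omega>, x)) \<in> borel_measurable borel" .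
    have "(\<integral>\<^sup>+h. G (?past \<omega>, h t) \<partial>distr M ?P' ?now) = (\<integral>\<^sup>+\<omega>'. G (?past \<omega>, z t \<omega>') \<partial>M)"
      by (subst nn_integral_distr[OF now]) simp_all
    also have "\<dots> = (\<integral>\<^sup>+x. G (?past \<omega>, x) \<partial>distr M borel (z t))"
      by (simp add: nn_integral_distr)
    also have "\<dots> = (\<integral>\<^sup>+x. g x * G (?past \<omega>, x) \<partial>lborel)"
      unfolding dz by (intro nn_integral_density) auto
    finally show "(\<integral>\<^sup>+h. G (?past \<omega>, h t) \<partial>distr M ?P' ?now) = (\<integral>\<^sup>+x. g x * G (?past \<omega>, x) \<partial>lborel)" .
  qed
  finally show ?thesis .
qed

lemma exponential_markov:
  assumes [measurable]: "f \<in> borel_measurable M"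
    and le: "(\<integral>\<^sup>+\<omega>. ennreal (exp (f \<omega>)) \<partial>M) \<le> ennreal (exp a)"
  shows "prob {\<omega> \<in> space M. s \<le> f \<omega>} \<le> exp (a - s)"
proof -
  have "emeasure M {\<omega> \<in> space M. 1 \<le> ennreal (exp (- s)) * ennreal (exp (f \<omega>))}
      \<le> ennreal (exp (- s)) * (\<integral>\<^sup>+\<omega>\<in>space M. ennreal (exp (f \<omega>)) \<partial>M)"
    by (rule nn_integral_Markov_inequality) auto
  also have "(\<integral>\<^sup>+\<omega>\<in>space M. ennreal (exp (f \<omega>)) \<partial>M) = (\<integral>\<^sup>+\<omega>. ennreal (exp (f \<omega>)) \<partial>M)"
    by (intro nn_integral_cong) simp
  also have "ennreal (exp (- s)) * \<dots> \<le> ennreal (exp (- s)) * ennreal (exp a)"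
    by (intro mult_left_mono le) auto
  also have "\<dots> = ennreal (exp (a - s))" by (simp add: exp_minus exp_diff field_simps flip: ennreal_mult)
  also have "{\<omega> \<in> space M. 1 \<le> ennreal (exp (- s)) * ennreal (exp (f \<omega>))} = {\<omega> \<in> space M. s \<le> f \<omega>}"
  proof (intro Collect_cong conj_cong refl)
    fix \<omega>
    have "ennreal (exp (- s)) * ennreal (exp (f \<omega>)) = ennreal (exp (f \<omega> - s))"
      by (simp flip: ennreal_mult exp_add)
    then show "1 \<le> ennreal (exp (- s)) * ennreal (exp (f \<omega>)) \<longleftrightarrow> s \<le> f \<omega>" by simp
  qed
  finally show ?thesis by (simp add: emeasure_eq_measure)
qed

text \<open>
  Condition on the samples before time \<open>k\<close>: they determine \<open>X k\<close> and the partial sum of the noise, while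
  the \<open>k\<close>-th sample is still standard Gaussian. Each step therefore multiplies the exponential moment by
  at most the bound of \<open>noise_mgf\<close>, which is uniform in the iterate.
\<close>

lemma noise_sum_mgf:
  fixes z :: "nat \<Rightarrow> 'a \<Rightarrow> real^'n" and \<Psi> :: "real^'n^'m" and V :: "real^'m^'m" and C Z :: "real^'n^'n"
    and \<mu> b \<eta> :: real
  assumes ind: "indep_vars (\<lambda>_. borel) z {..<T}"
    and gauss: "\<And>t. t < T \<Longrightarrow> distributed M lborel (z t) (\<lambda>x. ennreal (std_gaussian_density x))"
    and Psi: "transpose \<Psi> ** \<Psi> = mat 1" and V: "transpose V = V" and C: "transpose C = C"
    and Z: "Z \<in> fermi_set"
    and l: "0 \<le> l" "l * (norm_inf V * c_Psi \<Psi>) \<le> 1 / 4"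
  defines "X \<equiv> \<lambda>t \<omega>. mat_fun logistic (dual_iterate \<Psi> V C \<mu> b \<eta> (\<lambda>i. z i \<omega>) t)"
  shows "k \<le> T \<Longrightarrow> (\<integral>\<^sup>+\<omega>. ennreal (exp (l * (\<Sum>t<k. noise \<Psi> V Z (X t \<omega>) (z t \<omega>)))) \<partial>M)
    \<le> ennreal (exp (real k * (4 * real CARD('n) * (l * (norm_inf V * c_Psi \<Psi>))\<^sup>2)))"
proof (induction k)
  case 0
  show ?case by (simp add: emeasure_space_1)
next
  case (Suc k)
  define B where "B = 4 * real CARD('n) * (l * (norm_inf V * c_Psi \<Psi>))\<^sup>2"
  define x where "x = (\<lambda>t (f :: nat \<Rightarrow> real^'n). mat_fun logistic (dual_iterate \<Psi> V C \<mu> b \<eta> f t))"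
  define S where "S = (\<lambda>f. l * (\<Sum>t<k. noise \<Psi> V Z (x t f) (f t)))"
  define G where "G = (\<lambda>p. ennreal (exp (S (fst p))) * ennreal (exp (l * noise \<Psi> V Z (x k (fst p)) (snd p))))"
  let ?P = "PiM {..<k} (\<lambda>_. borel :: (real^'n) measure)"
  let ?past = "\<lambda>\<omega>. \<lambda>i\<in>{..<k}. z i \<omega>"
  have comp: "(\<lambda>p. fst p i) \<in> borel_measurable (?P \<Otimes>\<^sub>M borel)" if "i < k" for i
    using that by (intro measurable_compose[OF measurable_fst measurable_component_singleton]) simp
  have noise_m: "(\<lambda>p. noise \<Psi> V Z (x t (fst p)) (w p)) \<in> borel_measurable (?P \<Otimes>\<^sub>M borel)"
    if "t \<le> k" "w \<in> borel_measurable (?P \<Otimes>\<^sub>M borel)" for t w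
    unfolding x_def
    using that by (intro borel_measurable_noise_iterate C comp) auto
  have G: "G \<in> borel_measurable (?P \<Otimes>\<^sub>M borel)"
    unfolding G_def S_def
    by (intro borel_measurable_times_ennreal measurable_compose[OF _ measurable_ennreal]
        measurable_compose[OF _ borel_measurable_exp] borel_measurable_times borel_measurable_const
        borel_measurable_sum noise_m comp measurable_snd) auto
  have xX: "x t (?past \<omega>) = X t \<omega>" if "t \<le> k" for t \<omega>
    unfolding x_def X_def by (intro arg_cong[where f = "mat_fun logistic"] dual_iterate_cong) (use that in simp)
  have Sp: "S (?past \<omega>) = l * (\<Sum>t<k. noise \<Psi> V Z (X t \<omega>) (z t \<omega>))" for \<omega>
    unfolding S_def by (intro arg_cong2[where f = "(*)"] refl sum.cong) (simp_all add: xX)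
  have XF: "X t \<omega> \<in> fermi_set" for t \<omega>
    unfolding X_def by (intro logistic_in_fermi_set transpose_dual_iterate C)
  have inner: "(\<integral>\<^sup>+y. ennreal (std_gaussian_density y) * G (?past \<omega>, y) \<partial>lborel)
      \<le> ennreal (exp (S (?past \<omega>))) * ennreal (exp B)" for \<omega>
  proof -
    have m: "(\<lambda>y. std_gaussian_density y * exp (l * noise \<Psi> V Z (X k \<omega>) y)) \<in> borel_measurable borel"
      unfolding X_def
      using borel_measurable_continuous_onI[OF continuous_on_noise[of UNIV "\<lambda>_. dual_iterate \<Psi> V C \<mu> b \<eta> (\<lambda>i. z i \<omega>) k" "\<lambda>y. y" \<Psi> V Z]]
      by (intro borel_measurable_times borel_measurable_std_gaussian_density measurable_compose[OF _ borel_measurable_exp])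
         (auto simp: transpose_dual_iterate[OF C])
    have "(\<integral>\<^sup>+y. ennreal (std_gaussian_density y) * G (?past \<omega>, y) \<partial>lborel)
        = (\<integral>\<^sup>+y. ennreal (exp (S (?past \<omega>))) * ennreal (std_gaussian_density y * exp (l * noise \<Psi> V Z (X k \<omega>) y)) \<partial>lborel)"
      by (intro nn_integral_cong) (simp add: G_def xX ennreal_mult std_gaussian_density_nonneg mult_ac)
    also have "\<dots> = ennreal (exp (S (?past \<omega>))) * (\<integral>\<^sup>+y. ennreal (std_gaussian_density y * exp (l * noise \<Psi> V Z (X k \<omega>) y)) \<partial>lborel)"
      using m by (intro nn_integral_cmult) simp
    also have "\<dots> \<le> ennreal (exp (S (?past \<omega>))) * ennreal (exp B)"
      unfolding B_def by (intro mult_left_mono noise_mgf Psi V XF Z l) auto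
    finally show ?thesis .
  qed
  have "(\<integral>\<^sup>+\<omega>. ennreal (exp (l * (\<Sum>t<Suc k. noise \<Psi> V Z (X t \<omega>) (z t \<omega>)))) \<partial>M)
      = (\<integral>\<^sup>+\<omega>. G (?past \<omega>, z k \<omega>) \<partial>M)"
    by (intro nn_integral_cong) (simp add: G_def Sp xX distrib_left exp_add ennreal_mult)
  also have "\<dots> = (\<integral>\<^sup>+\<omega>. (\<integral>\<^sup>+y. ennreal (std_gaussian_density y) * G (?past \<omega>, y) \<partial>lborel) \<partial>M)"
    using Suc.prems by (intro nn_integral_independent_future[OF ind _ gauss G]) auto
  also have "\<dots> \<le> (\<integral>\<^sup>+\<omega>. ennreal (exp (S (?past \<omega>))) * ennreal (exp B) \<partial>M)"
    by (intro nn_integral_mono inner)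
  also have "\<dots> = (\<integral>\<^sup>+\<omega>. ennreal (exp (S (?past \<omega>))) \<partial>M) * ennreal (exp B)"
  proof (rule nn_integral_multc)
    have zm: "z i \<in> borel_measurable M" if "i < T" for i
      using distributed_measurable[OF gauss[OF that]] by simp
    have "(\<lambda>\<omega>. noise \<Psi> V Z (X t \<omega>) (z t \<omega>)) \<in> borel_measurable M" if "t < k" for t
      unfolding X_def
      using that Suc.prems by (intro borel_measurable_noise_iterate C zm) auto
    then show "(\<lambda>\<omega>. ennreal (exp (S (?past \<omega>)))) \<in> borel_measurable M"
      unfolding Sp by (intro measurable_compose[OF _ measurable_ennreal]
        measurable_compose[OF _ borel_measurable_exp] borel_measurable_times borel_measurable_const borel_measurable_sum) auto
  qed
  also have "\<dots> \<le> ennreal (exp (real k * B)) * ennreal (exp B)"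
    using Suc by (intro mult_right_mono) (simp_all add: Sp B_def)
  also have "\<dots> = ennreal (exp (real (Suc k) * B))"
    by (simp add: distrib_right add.commute flip: ennreal_mult exp_add)
  finally show ?case by (simp add: B_def)
qed

text \<open>
  The iterate \<open>X\<close> is a function of the earlier samples, and \<open>rho_sampled_matrix_mgf\<close> bounds the inner
  integral uniformly in it.
\<close>

lemma rho_sampled_iterate_mgf:
  fixes z :: "nat \<Rightarrow> 'a \<Rightarrow> real^'n" and \<Psi> :: "real^'n^'m" and V :: "real^'m^'m" and C :: "real^'n^'n"
    and \<mu> b \<eta> :: real
  assumes ind: "indep_vars (\<lambda>_. borel) z {..<T}"
    and gauss: "distributed M lborel (z t) (\<lambda>x. ennreal (std_gaussian_density x))"
    and C: "transpose C = C" and pos: "0 < c_Psi \<Psi>" and t: "t < T"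
  defines "X \<equiv> \<lambda>\<omega>. mat_fun logistic (dual_iterate \<Psi> V C \<mu> b \<eta> (\<lambda>i. z i \<omega>) t)"
  shows "(\<integral>\<^sup>+\<omega>. ennreal (exp (rho \<Psi> (sampled_matrix (X \<omega>) (z t \<omega>)) $ p / (4 * c_Psi \<Psi>))) \<partial>M) \<le> ennreal (exp (1 / 2))"
proof -
  define x where "x = (\<lambda>f :: nat \<Rightarrow> real^'n. mat_fun logistic (dual_iterate \<Psi> V C \<mu> b \<eta> f t))"
  define G where "G = (\<lambda>p'. ennreal (exp (rho \<Psi> (sampled_matrix (x (fst p')) (snd p')) $ p / (4 * c_Psi \<Psi>))))"
  let ?P = "PiM {..<t} (\<lambda>_. borel :: (real^'n) measure)"
  let ?past = "\<lambda>\<omega>. \<lambda>i\<in>{..<t}. z i \<omega>"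
  have comp: "(\<lambda>p. fst p i) \<in> borel_measurable (?P \<Otimes>\<^sub>M borel)" if "i < t" for i
    using that by (intro measurable_compose[OF measurable_fst measurable_component_singleton]) simp
  have "(\<lambda>p'. rho \<Psi> (sampled_matrix (x (fst p')) (snd p')) $ p) \<in> borel_measurable (?P \<Otimes>\<^sub>M borel)"
    unfolding x_def
    by (intro borel_measurable_rho_iterate C comp) auto
  then have G: "G \<in> borel_measurable (?P \<Otimes>\<^sub>M borel)" unfolding G_def by measurable
  have xX: "x (?past \<omega>) = X \<omega>" for \<omega>
    unfolding x_def X_def by (intro arg_cong[where f = "mat_fun logistic"] dual_iterate_cong) simp
  have XF: "X \<omega> \<in> fermi_set" for \<omega>
    unfolding X_def by (intro logistic_in_fermi_set transpose_dual_iterate C)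
  have "(\<integral>\<^sup>+\<omega>. ennreal (exp (rho \<Psi> (sampled_matrix (X \<omega>) (z t \<omega>)) $ p / (4 * c_Psi \<Psi>))) \<partial>M)
      = (\<integral>\<^sup>+\<omega>. G (?past \<omega>, z t \<omega>) \<partial>M)"
    by (intro nn_integral_cong) (simp add: G_def xX)
  also have "\<dots> = (\<integral>\<^sup>+\<omega>. (\<integral>\<^sup>+y. ennreal (std_gaussian_density y) * G (?past \<omega>, y) \<partial>lborel) \<partial>M)"
    by (rule nn_integral_independent_future[OF ind t gauss G])
  also have "\<dots> \<le> (\<integral>\<^sup>+\<omega>. ennreal (exp (1 / 2)) \<partial>M)"
  proof (rule nn_integral_mono)
    fix \<omega>
    show "(\<integral>\<^sup>+y. ennreal (std_gaussian_density y) * G (?past \<omega>, y) \<partial>lborel) \<le> ennreal (exp (1 / 2))"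
      using rho_sampled_matrix_mgf[OF XF pos, of \<omega> p]
      by (simp add: G_def xX ennreal_mult std_gaussian_density_nonneg)
  qed
  also have "\<dots> = ennreal (exp (1 / 2))" by (simp add: emeasure_space_1)
  finally show ?thesis .
qed

end

section \<open>The bound with high probability\<close>

text \<open>
  The balance of the terms for \<open>\<eta> = 1 / (D sqrt T)\<close> and noise at most \<open>sqrt (n T) D\<close>.
\<close>

lemma average_bound_of_regret_bound:
  fixes D :: real and T n :: nat and L :: "nat \<Rightarrow> real"
  assumes T: "1 \<le> T" and n: "1 \<le> n" and D: "0 < D"
    and regret: "(\<Sum>t<T. L t - L') \<le> real n * (ln 2 / (1 / (D * sqrt T)) + K
        + real T * ((1 / (D * sqrt T)) / 8 * D\<^sup>2)) + sqrt (real n * real T) * D"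
  shows "(1 / real T) * (\<Sum>t<T. L t / real n)
    \<le> L' / real n + D / sqrt (real T) * (ln 2 + 1/4 + 1 / sqrt (real n)) + K / real T"
proof -
  define q r where "q = sqrt (real T)" and "r = sqrt (real n)"
  have q: "0 < q" "real T = q * q" and r: "0 < r" "real n = r * r" using T n by (auto simp: q_def r_def)
  have rhs: "real n * (ln 2 / (1 / (D * sqrt T)) + K + real T * ((1 / (D * sqrt T)) / 8 * D\<^sup>2))
      + sqrt (real n * real T) * D
    = (real n * real T) * (D / q * (ln 2 + 1/8 + 1 / r) + K / real T)"
    unfolding real_sqrt_mult q_def[symmetric] r_def[symmetric] q(2) r(2)
    using q(1) r(1) D by (simp add: field_simps power2_eq_square)
  have nT: "0 < real n * real T" using q r by simp
  have "(\<Sum>t<T. L t) - real T * L' \<le> (real n * real T) * (D / q * (ln 2 + 1/8 + 1 / r) + K / real T)"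
    using regret unfolding rhs by (simp add: sum_subtractf)
  then have "((\<Sum>t<T. L t) - real T * L') / (real n * real T) \<le> D / q * (ln 2 + 1/8 + 1 / r) + K / real T"
    using nT by (simp add: pos_divide_le_eq mult.commute)
  also have "((\<Sum>t<T. L t) - real T * L') / (real n * real T) = (1 / real T) * (\<Sum>t<T. L t / real n) - L' / real n"
  proof -
    have "(1 / real T) * (\<Sum>t<T. L t / real n) = (\<Sum>t<T. L t) / (real n * real T)"
      by (simp flip: sum_divide_distrib)
    moreover have "real T * L' / (real n * real T) = L' / real n" using T by simp
    ultimately show ?thesis by (simp only: diff_divide_distrib)
  qed
  finally have "(1 / real T) * (\<Sum>t<T. L t / real n) \<le> L' / real n + D / q * (ln 2 + 1/8 + 1 / r) + K / real T"
    unfolding diff_le_eq by (simp only: add_ac)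
  also have "D / q * (ln 2 + 1/8 + 1 / r) \<le> D / q * (ln 2 + 1/4 + 1 / r)"
    using D q by (intro mult_left_mono) auto
  finally show ?thesis by (simp add: q_def r_def)
qed

theorem theorem17:
  fixes \<Psi> :: "real^'n^'m" and V :: "real^'m^'m" and C :: "real^'n^'n"
    and \<mu> :: real and \<beta> :: ereal and T :: nat and \<delta> :: real
    and c ch \<eta> \<gamma> :: real
    and M :: "'w measure" and z :: "nat \<Rightarrow> 'w \<Rightarrow> real^'n"
    and X :: "nat \<Rightarrow> 'w \<Rightarrow> real^'n^'n" and Xstar :: "real^'n^'n"
  assumes Psi: "transpose \<Psi> ** \<Psi> = mat 1"
    and V: "psd V"
    and C: "transpose C = C"
    and beta: "0 < \<beta>"
    and T: "1 \<le> T"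
    and delta: "0 < \<delta>" "\<delta> \<le> 1"
    and c_def: "c = 2 * (1 + 4 * ln (2 * real T * real CARD('m) / \<delta>))"
    and ch_def: "ch = c_Psi \<Psi> * norm_inf V"
    and ch_pos: "0 < ch"
    and eta_def: "\<eta> = 1 / (c * ch * sqrt (real T))"
    and gamma_def: "\<gamma> = step_size \<beta> \<eta>"
    and prob: "prob_space M"
    and indep: "prob_space.indep_vars M (\<lambda>_. borel) z {..<T}"
    and gauss: "\<And>t. t < T \<Longrightarrow> distributed M lborel (z t) (\<lambda>x. ennreal (std_gaussian_density x))"
    and init: "\<And>\<omega>. \<omega> \<in> space M \<Longrightarrow> X 0 \<omega> = (1/2) *\<^sub>R mat 1"
    and step: "(\<forall>\<omega>\<in>space M. \<forall>t<T.
                  mirror_step \<beta> \<mu> \<gamma> (stoch_grad \<Psi> V C (X t \<omega>) (z t \<omega>)) (X t \<omega>) (X (Suc t) \<omega>))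
             \<or> (\<forall>\<omega>\<in>space M. \<forall>t<T.
                  proximal_step \<Psi> V C \<beta> \<mu> \<eta> (stoch_grad \<Psi> V C (X t \<omega>) (z t \<omega>)) (X t \<omega>) (X (Suc t) \<omega>))"
    and minimizer: "is_arg_min (\<lambda>Y. free_energy \<Psi> V C \<beta> Y - \<mu> * trace Y) (\<lambda>Y. Y \<in> fermi_set) Xstar"
  shows "measure M {\<omega> \<in> space M.
           (1 / real T) * (\<Sum>t<T. (free_energy \<Psi> V C \<beta> (X t \<omega>) - \<mu> * trace (X t \<omega>)) / real CARD('n))
           \<le> (free_energy \<Psi> V C \<beta> Xstar - \<mu> * trace Xstar) / real CARD('n)
             + c * ch / sqrt (real T) * (ln 2 + 1/4 + 1 / sqrt (real CARD('n)))
             + onorm ((*v) (C - \<mu> *\<^sub>R mat 1)) / real T}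
         \<ge> 1 - \<delta>"

proof -
  interpret prob_space M by (rule prob)
  define n where "n = real CARD('n)"
  define m where "m = real CARD('m)"
  define Lg where "Lg = ln (2 * real T * m / \<delta>)"
  have n1: "1 \<le> n" and m1: "1 \<le> m" unfolding n_def m_def by (simp_all add: Suc_leI)
  have T1: "1 \<le> real T" using T by simp
  have Tm: "1 \<le> real T * m" using mult_mono[OF T1 m1] by simp
  have ge2: "2 \<le> 2 * real T * m / \<delta>"
  proof -
    have "2 * \<delta> \<le> 2 * (real T * m)" using Tm delta by linarith
    then show ?thesis using delta by (simp add: pos_le_divide_eq mult.assoc)
  qed
  have Lg: "0 < Lg" unfolding Lg_def using ge2 by (intro ln_gt_zero) linarith
  have c: "c = 2 + 8 * Lg" unfolding c_def Lg_def m_def by simp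
  have expL: "exp (- Lg) = \<delta> / (2 * real T * m)"
    using ge2 unfolding Lg_def by (simp add: exp_minus inverse_eq_divide)
  \<comment> \<open>Every bad event below has probability at most \<open>exp (- 2 * Lg)\<close>; the union bound allows \<open>\<delta> / (2 * T * m)\<close> for each.\<close>
  have exp2L: "exp (- 2 * Lg) \<le> \<delta> / (2 * real T * m)"
  proof -
    have "exp (- 2 * Lg) \<le> exp (- Lg)" using Lg by simp
    then show ?thesis by (simp only: expL)
  qed
  have cpos: "0 < c" using c Lg by simp
  have etapos: "0 < \<eta>" unfolding eta_def using cpos ch_pos T1 by simp
  have "0 \<le> norm_inf V" unfolding norm_inf_def
    by (rule order_trans[OF _ Max_ge[of _ "\<Sum>j\<in>UNIV. \<bar>V $ undefined $ j\<bar>"]]) (auto intro: sum_nonneg)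
  moreover have "0 \<le> c_Psi \<Psi>" using row_norm_le_c_Psi zero_le_power2 order_trans by blast
  ultimately have cP: "0 < c_Psi \<Psi>" using ch_pos unfolding ch_def by (auto simp: zero_less_mult_iff)
  have ch: "norm_inf V * c_Psi \<Psi> = ch" by (simp add: ch_def)
  have tV: "transpose V = V" using V by (simp add: psd_def)
  have Z: "Xstar \<in> fermi_set" using minimizer by (simp add: is_arg_min_def)

  define Y where "Y = (\<lambda>t \<omega>. dual_iterate \<Psi> V C \<mu> (beta_inv \<beta>) \<eta> (\<lambda>i. z i \<omega>) t)"
  have X: "X t \<omega> = mat_fun logistic (Y t \<omega>)" if "\<omega> \<in> space M" "t \<le> T" for t \<omega>
    unfolding Y_def
    by (rule iterate_eq_logistic_dual_iterate[OF C beta etapos, where X = "\<lambda>t. X t \<omega>" and T = T])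
       (use that init step gamma_def in auto)
  have zm: "z i \<in> borel_measurable M" if "i < T" for i
    using distributed_measurable[OF gauss[OF that]] by simp
  have Ym: "Y t \<in> borel_measurable M" if "t \<le> T" for t
    unfolding Y_def using that zm by (intro borel_measurable_dual_iterate C) auto
  have Ysym: "transpose (Y t \<omega>) = Y t \<omega>" for t \<omega> unfolding Y_def by (rule transpose_dual_iterate[OF C])

  define rh where "rh = (\<lambda>t p \<omega>. rho \<Psi> (sampled_matrix (mat_fun logistic (Y t \<omega>)) (z t \<omega>)) $ p)"
  define ns where "ns = (\<lambda>t \<omega>. noise \<Psi> V Xstar (mat_fun logistic (Y t \<omega>)) (z t \<omega>))"
  have rhm: "rh t p \<in> borel_measurable M" if "t < T" for t p
    unfolding rh_def Y_def using that zm
    by (intro borel_measurable_rho_iterate C) auto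
  have nsm: "ns t \<in> borel_measurable M" if "t < T" for t
    unfolding ns_def Y_def using that zm
    by (intro borel_measurable_noise_iterate C) auto

  \<comment> \<open>With this exponent the second moment term of \<open>noise_sum_mgf\<close> is \<open>1 / 4\<close>, and the threshold for the noise becomes \<open>c / 4\<close>.\<close>
  define l where "l = 1 / (4 * ch * sqrt (n * real T))"
  have nT: "1 \<le> n * real T" using mult_mono[OF n1 T1] n1 by simp
  have l: "0 < l" "l * ch \<le> 1 / 4" "4 * n * (l * ch)\<^sup>2 * real T = 1 / 4" "l * (sqrt (n * real T) * (c * ch)) = c / 4"
  proof -
    have s: "1 \<le> sqrt (n * real T)" using nT by simp
    have lch: "l * ch = 1 / (4 * sqrt (n * real T))" using ch_pos by (simp add: l_def)
    show "0 < l" unfolding l_def using ch_pos s by simp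
    show "l * ch \<le> 1 / 4" unfolding lch using s by (simp add: field_simps)
    show "4 * n * (l * ch)\<^sup>2 * real T = 1 / 4"
      unfolding lch using n1 T by (simp add: power_divide power_mult_distrib)
    show "l * (sqrt (n * real T) * (c * ch)) = c / 4" unfolding l_def using n1 T ch_pos by (simp add: field_simps)
  qed

  \<comment> \<open>A bad event is that an entry of the sampled density exceeds \<open>c * c_Psi \<Psi>\<close>, or that the total noise exceeds \<open>sqrt (n * T) * (c * ch)\<close>.\<close>
  define A where "A = (\<lambda>(t, p). {\<omega> \<in> space M. c / 4 \<le> rh t p \<omega> / (4 * c_Psi \<Psi>)})"
  define B where "B = {\<omega> \<in> space M. c / 4 \<le> l * (\<Sum>t<T. ns t \<omega>)}"
  let ?I = "{..<T} \<times> (UNIV :: 'm set)"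
  have Aset: "A i \<in> events" if "i \<in> ?I" for i
    unfolding A_def using that rhm by (cases i) auto
  have Bset: "B \<in> events" unfolding B_def using nsm by measurable
  have PA: "prob (A i) \<le> \<delta> / (2 * real T * m)" if i: "i \<in> ?I" for i
  proof -
    obtain t p where "i = (t, p)" and t: "t < T" using i by (cases i) auto
    have "(\<integral>\<^sup>+\<omega>. ennreal (exp (rh t p \<omega> / (4 * c_Psi \<Psi>))) \<partial>M) \<le> ennreal (exp (1 / 2))"
      unfolding rh_def Y_def by (rule rho_sampled_iterate_mgf[OF indep gauss[OF t] C cP t])
    then have "prob {\<omega> \<in> space M. c / 4 \<le> rh t p \<omega> / (4 * c_Psi \<Psi>)} \<le> exp (1 / 2 - c / 4)"
      by (intro exponential_markov borel_measurable_divide rhm t borel_measurable_const)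
    then have "prob (A i) \<le> exp (1 / 2 - c / 4)" by (simp only: A_def \<open>i = (t, p)\<close> prod.case)
    also have "1 / 2 - c / 4 = - 2 * Lg" unfolding c by (simp add: field_simps)
    also note exp2L
    finally show ?thesis .
  qed
  have PB: "prob B \<le> \<delta> / 2"
  proof -
    have "(\<integral>\<^sup>+\<omega>. ennreal (exp (l * (\<Sum>t<T. ns t \<omega>))) \<partial>M)
        \<le> ennreal (exp (real T * (4 * real CARD('n) * (l * (norm_inf V * c_Psi \<Psi>))\<^sup>2)))"
      unfolding ns_def Y_def
      by (rule noise_sum_mgf[OF indep gauss Psi tV C Z, where l = l and k = T]) (use l in \<open>simp_all add: ch\<close>)
    also have "real CARD('n) = n" by (simp only: n_def)
    also note ch
    also have "real T * (4 * n * (l * ch)\<^sup>2) = 1 / 4" using l(3) by (simp only: mult.commute)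
    finally have "prob B \<le> exp (1 / 4 - c / 4)"
      unfolding B_def
      by (intro exponential_markov borel_measurable_times borel_measurable_const borel_measurable_sum nsm) simp
    also have "\<dots> \<le> exp (- 2 * Lg)" unfolding exp_le_cancel_iff c by (simp add: field_simps)
    also note exp2L
    also have "\<delta> / (2 * real T * m) \<le> \<delta> / 2"
    proof (rule divide_left_mono)
      show "2 \<le> 2 * real T * m" using Tm by (simp add: mult.assoc)
      then show "0 < 2 * real T * m * 2" by linarith
    qed (use delta in simp)
    finally show ?thesis .
  qed
  define bad where "bad = (\<Union>i\<in>?I. A i) \<union> B"
  have badset: "bad \<in> events" unfolding bad_def using Aset Bset by auto
  have "prob bad \<le> prob (\<Union>i\<in>?I. A i) + prob B"
    unfolding bad_def using Aset Bset by (intro measure_Un_le) auto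
  also have "prob (\<Union>i\<in>?I. A i) \<le> (\<Sum>i\<in>?I. prob (A i))"
    using Aset by (intro measure_UNION_le) auto
  also have "\<dots> \<le> (\<Sum>i\<in>?I. \<delta> / (2 * real T * m))" by (intro sum_mono PA)
  also have "\<dots> = \<delta> / 2" using T by (simp add: card_cartesian_product m_def)
  finally have Pbad: "prob bad \<le> \<delta>" using PB by simp

  let ?L = "\<lambda>W. free_energy \<Psi> V C \<beta> W - \<mu> * trace W"
  let ?good = "{\<omega> \<in> space M.
           (1 / real T) * (\<Sum>t<T. ?L (X t \<omega>) / real CARD('n))
           \<le> ?L Xstar / real CARD('n)
             + c * ch / sqrt (real T) * (ln 2 + 1/4 + 1 / sqrt (real CARD('n)))
             + onorm ((*v) (C - \<mu> *\<^sub>R mat 1)) / real T}"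
  have Lm: "(\<lambda>\<omega>. ?L (X t \<omega>)) \<in> borel_measurable M" if "t < T" for t
  proof -
    have "(\<lambda>\<omega>. ?L (mat_fun logistic (Y t \<omega>))) \<in> borel_measurable M"
      by (rule borel_measurable_continuous_on_compose[OF continuous_on_free_energy_logistic])
         (use Ym that Ysym in auto)
    then show ?thesis using X that by (subst measurable_cong[where g = "\<lambda>\<omega>. ?L (mat_fun logistic (Y t \<omega>))"]) auto
  qed
  \<comment> \<open>A set that is not an event has measure \<open>0\<close> by convention, so the claim includes that this one is an event.\<close>
  have goodset: "?good \<in> events"
    by (intro borel_measurable_le borel_measurable_times borel_measurable_const borel_measurable_sum
        borel_measurable_divide Lm) simp
  have sub: "space M - bad \<subseteq> ?good"
  proof
    fix \<omega> assume w: "\<omega> \<in> space M - bad"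
    have rho_le: "\<bar>rh t p \<omega>\<bar> \<le> c * c_Psi \<Psi>" if "t < T" for t p
    proof -
      have "\<omega> \<notin> A (t, p)" using w that by (auto simp: bad_def)
      then have "rh t p \<omega> / (4 * c_Psi \<Psi>) < c / 4" using w by (auto simp: A_def)
      then have "rh t p \<omega> < c * c_Psi \<Psi>" using cP by (simp add: field_simps)
      moreover have "0 \<le> rh t p \<omega>"
        unfolding rh_def by (subst rho_sampled_matrix) (simp_all add: logistic_in_fermi_set Ysym)
      ultimately show ?thesis by simp
    qed
    have "l * (\<Sum>t<T. ns t \<omega>) < l * (sqrt (n * real T) * (c * ch))"
      using w unfolding l(4) by (auto simp: bad_def B_def)
    then have noise_le: "(\<Sum>t<T. ns t \<omega>) \<le> sqrt (n * real T) * (c * ch)" using l(1) by simp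
    have w': "\<omega> \<in> space M" using w by simp
    have "(\<Sum>t<T. ?L (X t \<omega>) - ?L Xstar) = (\<Sum>t<T. ?L (mat_fun logistic (Y t \<omega>)) - ?L Xstar)"
      by (intro sum.cong refl) (simp add: X[OF w'])
    also have "\<dots> \<le> n * (ln 2 / \<eta> + onorm ((*v) (C - \<mu> *\<^sub>R mat 1)) + real T * (\<eta> / 8 * (norm_inf V * (c * c_Psi \<Psi>))\<^sup>2))
      + (\<Sum>t<T. ns t \<omega>)"
      unfolding n_def ns_def Y_def
      by (rule mirror_descent_regret[OF Psi V C Z etapos beta]) (use rho_le in \<open>simp add: rh_def Y_def\<close>)
    also have "\<dots> \<le> n * (ln 2 / \<eta> + onorm ((*v) (C - \<mu> *\<^sub>R mat 1)) + real T * (\<eta> / 8 * (c * ch)\<^sup>2))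
      + sqrt (n * real T) * (c * ch)"
      using noise_le by (simp add: ch_def mult_ac)
    finally show "\<omega> \<in> ?good"
      using average_bound_of_regret_bound[OF T, of "CARD('n)" "c * ch" "\<lambda>t. ?L (X t \<omega>)" "?L Xstar"] w' cpos ch_pos
      unfolding eta_def n_def by (simp add: Suc_leI)
  qed
  have "1 - \<delta> \<le> 1 - prob bad" using Pbad by simp
  also have "\<dots> = prob (space M - bad)" using prob_compl[OF badset] by simp
  also have "\<dots> \<le> prob ?good" by (rule finite_measure_mono[OF sub goodset])
  finally show ?thesis .
qed

end
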